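(* Let $\Gamma$ be a group of type $F$ and geometric dimension $\le n$. Then $$\ker D_{i-1}=\mathcal{SC}_i$$ for every integer $i\ge(n+1)/2$.
   Context: $\mathbb{R}\Gamma$ is the real group algebra with involution $(\sum a_\gamma\gamma)^*=\sum a_\gamma\gamma^{-1}$; $\mathbb{M}_{k\times l}(\mathbb{R}\Gamma)$ denotes $k\times l$ matrices over $\mathbb{R}\Gamma$, $\mathbb{M}_k=\mathbb{M}_{k\times k}$, and for a matrix $x$, $x^*$ is the transpose of $x$ with the involution applied to each entry. Finiteness: $\Gamma$ is of type $F_m$ if it acts freely by simplicial automorphisms on a locally finite contractible simplicial complex $X$ such that, for every $i\le m$, the set $X^{(i)}$ of $i$-simplices has a finite number $k_i$ of $\Gamma$-orbits; it is of type $F$ if $X$ can be chosen with finitely many $\Gamma$-orbits of simplices in total. Fix such an $X$ (here with finitely many orbits of simplices in total; $k_i=0$ when there are no $i$-simplices). Codifferentials: fix a $\Gamma$-invariant orientation of the simplices of $X$ and representatives $\tau^i_1,\dots,\tau^i_{k_i}$ of the $\Gamma$-orbits in $X^{(i)}$. Writing the simplicial boundary as $\partial\tau^{i+1}_p=\sum_{q}\sum_{\gamma\in\Gamma}\varepsilon_{pq}(\gamma)\,\gamma\tau^i_q$, let $d_i\in\mathbb{M}_{k_{i+1}\times k_i}(\mathbb{R}\Gamma)$ be the matrix with entries $(d_i)_{pq}=\sum_\gamma\varepsilon_{pq}(\gamma)\gamma$. Then $d_id_{i-1}=0$. Define $D_i:\mathbb{M}_{k_{i+1}}(\mathbb{R}\Gamma)\to\mathbb{M}_{k_i}(\mathbb{R}\Gamma)$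 by $D_i(a)=d_i^*ad_i$, and the $i$-th split conjugation space $$\mathcal{SC}_i=\{d_i^*x+yd_i:\ x\in\mathbb{M}_{k_{i+1}\times k_i}(\mathbb{R}\Gamma),\ y\in\mathbb{M}_{k_i\times k_{i+1}}(\mathbb{R}\Gamma)\}\subseteq\mathbb{M}_{k_i}(\mathbb{R}\Gamma).$$ *)

theory Defs
  imports
    "HOL-Analysis.Analysis"
    "HOL-Combinatorics.Permutations"
    "HOL-Library.Poly_Mapping"
    "Jordan_Normal_Form.Matrix"
begin

text \<open>
  A group is a type of class \<open>group_add\<close>: the class does not assume commutativity, and only the
  notation is additive (unit \<open>0\<close>, product \<open>g + h\<close>, inverse \<open>- g\<close>). The real group algebra of
  \<open>'g\<close> is the ring \<open>'g \<Rightarrow>\<^sub>0 real\<close> of finitely supported functions with the convolution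
  product, in which \<open>Poly_Mapping.single g r\<close> is the element \<open>r g\<close>. Matrices over it
  are those of \<open>Jordan_Normal_Form.Matrix\<close>, where the dimensions may be \<open>0\<close>.
\<close>

type_synonym 'g group_algebra = "'g \<Rightarrow>\<^sub>0 real"

definition ga_star :: "'g::group_add group_algebra \<Rightarrow> 'g group_algebra" where
  "ga_star a = Poly_Mapping.map_key uminus a"

definition mat_star :: "'g::group_add group_algebra mat \<Rightarrow> 'g group_algebra mat" where
  "mat_star A = map_mat ga_star (transpose_mat A)"


subsection \<open>Simplicial complexes and their geometric realization\<close>

text \<open>A complex is the set of its (nonempty) simplices, each simplex being its set of vertices;
  the vertex set is \<open>\<Union>K\<close>.\<close>

definition abstract_simplicial_complex :: "'v set set \<Rightarrow> bool" where
  "abstract_simplicial_complex K \<longleftrightarrow>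
     (\<forall>s\<in>K. finite s \<and> s \<noteq> {} \<and> (\<forall>t. t \<subseteq> s \<and> t \<noteq> {} \<longrightarrow> t \<in> K))"

definition simplices :: "'v set set \<Rightarrow> nat \<Rightarrow> 'v set set" where
  "simplices K i = {s \<in> K. card s = i + 1}"

definition dimension_le :: "'v set set \<Rightarrow> nat \<Rightarrow> bool" where
  "dimension_le K n \<longleftrightarrow> (\<forall>s\<in>K. card s \<le> n + 1)"

definition locally_finite_complex :: "'v set set \<Rightarrow> bool" where
  "locally_finite_complex K \<longleftrightarrow> (\<forall>v\<in>\<Union>K. finite {s \<in> K. v \<in> s})"

text \<open>Points of the realization are given by their barycentric coordinates.\<close>

definition closed_simplex :: "'v set \<Rightarrow> ('v \<Rightarrow> real) set" where
  "closed_simplex s = {t. (\<forall>v. 0 \<le> t v) \<and> (\<forall>v. v \<notin> s \<longrightarrow> t v = 0) \<and> (\<Sum>v\<in>s. t v) = 1}"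

definition realization :: "'v set set \<Rightarrow> ('v \<Rightarrow> real) set" where
  "realization K = (\<Union>s\<in>K. closed_simplex s)"

text \<open>The weak topology: a set is open iff it meets every closed simplex in a set that is
  open in the Euclidean topology of that simplex, which is the one induced by the
  product topology of \<open>'v \<Rightarrow> real\<close>.\<close>

definition realization_topology :: "'v set set \<Rightarrow> ('v \<Rightarrow> real) topology" where
  "realization_topology K = topology (\<lambda>U. U \<subseteq> realization K \<and>
     (\<forall>s\<in>K. openin (top_of_set (closed_simplex s)) (U \<inter> closed_simplex s)))"

lemma openin_realization_topology:
  "openin (realization_topology K) U \<longleftrightarrow> U \<subseteq> realization K \<and>
     (\<forall>s\<in>K. openin (top_of_set (closed_simplex s)) (U \<inter> closed_simplex s))"
proof -
  have "istopology (\<lambda>U. U \<subseteq> realization K \<and>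
     (\<forall>s\<in>K. openin (top_of_set (closed_simplex s)) (U \<inter> closed_simplex s)))"
    unfolding istopology_def
  proof (intro conjI allI impI ballI)
    fix S T s
    assume S: "S \<subseteq> realization K \<and>
              (\<forall>s\<in>K. openin (top_of_set (closed_simplex s)) (S \<inter> closed_simplex s))"
      and T: "T \<subseteq> realization K \<and>
              (\<forall>s\<in>K. openin (top_of_set (closed_simplex s)) (T \<inter> closed_simplex s))"
      and s: "s \<in> K"
    have "openin (top_of_set (closed_simplex s)) ((S \<inter> closed_simplex s) \<inter> (T \<inter> closed_simplex s))"
      by (rule openin_Int[OF bspec[OF conjunct2[OF S] s] bspec[OF conjunct2[OF T] s]])
    moreover have "(S \<inter> closed_simplex s) \<inter> (T \<inter> closed_simplex s) = S \<inter> T \<inter> closed_simplex s"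
      by blast
    ultimately show "openin (top_of_set (closed_simplex s)) (S \<inter> T \<inter> closed_simplex s)"
      by metis
  next
    fix \<K> s
    assume "\<forall>S\<in>\<K>. S \<subseteq> realization K \<and>
              (\<forall>s\<in>K. openin (top_of_set (closed_simplex s)) (S \<inter> closed_simplex s))"
      and "s \<in> K"
    then have "\<forall>U\<in>(\<lambda>S. S \<inter> closed_simplex s) ` \<K>. openin (top_of_set (closed_simplex s)) U"
      by blast
    then have "openin (top_of_set (closed_simplex s)) (\<Union>S\<in>\<K>. S \<inter> closed_simplex s)"
      by (intro openin_Union) blast
    moreover have "(\<Union>S\<in>\<K>. S \<inter> closed_simplex s) = \<Union>\<K> \<inter> closed_simplex s"
      by blast
    ultimately show "openin (top_of_set (closed_simplex s)) (\<Union>\<K> \<inter> closed_simplex s)"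
      by metis
  qed blast+
  then show ?thesis
    by (simp add: realization_topology_def topology_inverse')
qed


subsection \<open>Free actions, finiteness type and geometric dimension\<close>

text \<open>Actions are only constrained on the vertices of the complex.\<close>

definition simplicial_action :: "('g::group_add \<Rightarrow> 'v \<Rightarrow> 'v) \<Rightarrow> 'v set set \<Rightarrow> bool" where
  "simplicial_action act K \<longleftrightarrow>
     (\<forall>v\<in>\<Union>K. act 0 v = v) \<and>
     (\<forall>g h. \<forall>v\<in>\<Union>K. act (g + h) v = act g (act h v)) \<and>
     (\<forall>g. \<forall>s\<in>K. act g ` s \<in> K)"

definition realization_act ::
    "('g::group_add \<Rightarrow> 'v \<Rightarrow> 'v) \<Rightarrow> 'v set set \<Rightarrow> 'g \<Rightarrow> ('v \<Rightarrow> real) \<Rightarrow> ('v \<Rightarrow> real)" where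
  "realization_act act K g t = (\<lambda>v. if v \<in> \<Union>K then t (act (- g) v) else 0)"

text \<open>Freeness is required on all points of the realization. It implies that the setwise
  stabilizer of every simplex is trivial (consider barycentres), which is more than
  freeness on the vertices.\<close>

definition free_action :: "('g::group_add \<Rightarrow> 'v \<Rightarrow> 'v) \<Rightarrow> 'v set set \<Rightarrow> bool" where
  "free_action act K \<longleftrightarrow>
     (\<forall>g. \<forall>t\<in>realization K. realization_act act K g t = t \<longrightarrow> g = 0)"

text \<open>\<open>K \<noteq> {}\<close> is needed because \<^const>\<open>contractible_space\<close> holds for the empty space.\<close>

definition free_contractible_complex :: "('g::group_add \<Rightarrow> 'v \<Rightarrow> 'v) \<Rightarrow> 'v set set \<Rightarrow> bool" where
  "free_contractible_complex act K \<longleftrightarrow>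
     abstract_simplicial_complex K \<and> K \<noteq> {} \<and> contractible_space (realization_topology K) \<and>
     simplicial_action act K \<and> free_action act K"

definition simplex_orbit :: "('g \<Rightarrow> 'v \<Rightarrow> 'v) \<Rightarrow> 'v set \<Rightarrow> 'v set set" where
  "simplex_orbit act s = range (\<lambda>g. act g ` s)"

definition num_orbits :: "('g \<Rightarrow> 'v \<Rightarrow> 'v) \<Rightarrow> 'v set set \<Rightarrow> nat \<Rightarrow> nat" where
  "num_orbits act K i = card (simplex_orbit act ` simplices K i)"

text \<open>The complexes that witness type \<open>F\<close>: the group \<open>'g\<close> is of type \<open>F\<close> iff such an \<open>act\<close> and
  \<open>K\<close> exist.\<close>

definition type_F_complex :: "('g::group_add \<Rightarrow> 'v \<Rightarrow> 'v) \<Rightarrow> 'v set set \<Rightarrow> bool" where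
  "type_F_complex act K \<longleftrightarrow>
     free_contractible_complex act K \<and> locally_finite_complex K \<and>
     finite (simplex_orbit act ` K)"

text \<open>The group has a free contractible simplicial complex, with vertices in \<open>'w\<close>, of
  dimension at most \<open>n\<close>. No finiteness of the complex is required. A quantifier over types not
  being available, the vertex type is a parameter; as an assumption of a theorem in which
  \<open>'w\<close> is a type variable not occurring elsewhere, the predicate says that there is such a complex
  with some vertex type.\<close>

definition geometric_dimension_le :: "'w itself \<Rightarrow> 'g::group_add itself \<Rightarrow> nat \<Rightarrow> bool" where
  "geometric_dimension_le W G n \<longleftrightarrow>
     (\<exists>(act :: 'g \<Rightarrow> 'w \<Rightarrow> 'w) K. free_contractible_complex act K \<and> dimension_le K n)"


subsection \<open>Orientations, codifferentials and split conjugation spaces\<close>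

text \<open>An orientation assigns a sign to every ordering of the vertices of every simplex,
  changing by the sign of a permutation of the ordering; the orderings of
  sign \<open>1\<close> are the positively oriented ones. A \<open>0\<close>-simplex has only one orientation. Invariance
  means that the group maps positive orderings to positive orderings.\<close>

definition invariant_orientation ::
    "('g \<Rightarrow> 'v \<Rightarrow> 'v) \<Rightarrow> 'v set set \<Rightarrow> ('v list \<Rightarrow> int) \<Rightarrow> bool" where
  "invariant_orientation act K ori \<longleftrightarrow>
     (\<forall>v\<in>\<Union>K. ori [v] = 1) \<and>
     (\<forall>xs. distinct xs \<and> set xs \<in> K \<longrightarrow>
        ori xs \<in> {1, -1} \<and>
        (\<forall>p. p permutes {..<length xs} \<longrightarrow> ori (permute_list p xs) = sign p * ori xs) \<and>
        (\<forall>g. ori (map (act g) xs) = ori xs))"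

definition orbit_representatives ::
    "('g \<Rightarrow> 'v \<Rightarrow> 'v) \<Rightarrow> 'v set set \<Rightarrow> (nat \<Rightarrow> nat \<Rightarrow> 'v set) \<Rightarrow> bool" where
  "orbit_representatives act K \<tau> \<longleftrightarrow>
     (\<forall>i. (\<forall>p<num_orbits act K i. \<tau> i p \<in> simplices K i) \<and>
          bij_betw (\<lambda>p. simplex_orbit act (\<tau> i p)) {..<num_orbits act K i}
            (simplex_orbit act ` simplices K i))"

text \<open>\<open>\<partial>[x\<^sub>0, \<dots>, x\<^sub>m] = \<Sum>j. (-1)\<^sup>j [x\<^sub>0, \<dots>, (omit x\<^sub>j), \<dots>, x\<^sub>m]\<close> for a positive ordering of the simplex,
  as a chain in the basis of positively oriented simplices; the value does not depend
  on the choice of the positive ordering. Only meant for simplices of dimension at least \<open>1\<close>.\<close>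

definition boundary :: "('v list \<Rightarrow> int) \<Rightarrow> 'v set \<Rightarrow> ('v set \<Rightarrow>\<^sub>0 real)" where
  "boundary ori s =
     (let xs = (SOME xs. distinct xs \<and> set xs = s \<and> ori xs = 1) in
      \<Sum>j<length xs. let ys = take j xs @ drop (Suc j) xs in
        Poly_Mapping.single (set ys) ((-1) ^ j * real_of_int (ori ys)))"

text \<open>The coefficient of \<open>\<gamma> \<tau> i q\<close> in the boundary of \<open>\<tau> (i + 1) p\<close> is the coefficient of \<open>\<gamma>\<close>
  in the entry \<open>(p, q)\<close>. For a free action the summation range is finite.\<close>

definition codiff :: "('g::group_add \<Rightarrow> 'v \<Rightarrow> 'v) \<Rightarrow> 'v set set \<Rightarrow> ('v list \<Rightarrow> int) \<Rightarrow>
    (nat \<Rightarrow> nat \<Rightarrow> 'v set) \<Rightarrow> nat \<Rightarrow> 'g group_algebra mat" where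
  "codiff act K ori \<tau> i =
     mat (num_orbits act K (i + 1)) (num_orbits act K i) (\<lambda>(p, q).
       let \<epsilon> = (\<lambda>\<gamma>. Poly_Mapping.lookup (boundary ori (\<tau> (i + 1) p)) (act \<gamma> ` \<tau> i q)) in
       \<Sum>\<gamma> | \<epsilon> \<gamma> \<noteq> 0. Poly_Mapping.single \<gamma> (\<epsilon> \<gamma>))"

definition conj_map :: "('g::group_add \<Rightarrow> 'v \<Rightarrow> 'v) \<Rightarrow> 'v set set \<Rightarrow> ('v list \<Rightarrow> int) \<Rightarrow>
    (nat \<Rightarrow> nat \<Rightarrow> 'v set) \<Rightarrow> nat \<Rightarrow> 'g group_algebra mat \<Rightarrow> 'g group_algebra mat" where
  "conj_map act K ori \<tau> i a =
     mat_star (codiff act K ori \<tau> i) * a * codiff act K ori \<tau> i"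

definition ker_conj_map :: "('g::group_add \<Rightarrow> 'v \<Rightarrow> 'v) \<Rightarrow> 'v set set \<Rightarrow> ('v list \<Rightarrow> int) \<Rightarrow>
    (nat \<Rightarrow> nat \<Rightarrow> 'v set) \<Rightarrow> nat \<Rightarrow> 'g group_algebra mat set" where
  "ker_conj_map act K ori \<tau> i =
     {a \<in> carrier_mat (num_orbits act K (i + 1)) (num_orbits act K (i + 1)).
        conj_map act K ori \<tau> i a = 0\<^sub>m (num_orbits act K i) (num_orbits act K i)}"

definition split_conjugation_space :: "('g::group_add \<Rightarrow> 'v \<Rightarrow> 'v) \<Rightarrow> 'v set set \<Rightarrow>
    ('v list \<Rightarrow> int) \<Rightarrow> (nat \<Rightarrow> nat \<Rightarrow> 'v set) \<Rightarrow> nat \<Rightarrow> 'g group_algebra mat set" where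
  "split_conjugation_space act K ori \<tau> i =
     {mat_star (codiff act K ori \<tau> i) * x + y * codiff act K ori \<tau> i | x y.
        x \<in> carrier_mat (num_orbits act K (i + 1)) (num_orbits act K i) \<and>
        y \<in> carrier_mat (num_orbits act K i) (num_orbits act K (i + 1))}"

end

theory Submission
  imports Defs "HOL-Homology.Homology" "HOL-Analysis.Finite_Function_Topology"
begin

text \<open>
  Right multiplication by the \<open>d\<^sub>i\<close> is the oriented chain complex of \<open>X\<close>, which is exact because
  \<open>X\<close> is contractible: a cycle of ordered simplices bounds singularly, and after subdivision the
  bounding singular chain is pushed back to \<open>X\<close> by sending every vertex of a small singular simplex to
  a vertex of \<open>X\<close> with maximal barycentric coordinate. Comparing \<open>X\<close> with a free contractible complex of
  dimension at most \<open>n\<close>, which is oriented equivariantly first, gives matrices with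
  \<open>d\<^sub>p\<^sub>-\<^sub>1 h\<^sub>p\<^sub>-\<^sub>1 + h\<^sub>p d\<^sub>p = 1\<close> for \<open>p > n\<close>.

  Consider the double complex of the matrix spaces \<open>M\<^sub>p\<^sub>,\<^sub>q\<close> of size \<open>k\<^sub>p \<times> k\<^sub>q\<close> with the differentials
  \<open>a \<mapsto> d\<^sub>p\<^sub>-\<^sub>1\<^sup>* a\<close> and \<open>a \<mapsto> a d\<^sub>q\<^sub>-\<^sub>1\<close>. If \<open>d\<^sub>i\<^sub>-\<^sub>1\<^sup>* a d\<^sub>i\<^sub>-\<^sub>1 = 0\<close>, then a zigzag through exact rows and
  columns leads from \<open>a\<close> to \<open>M\<^sub>2\<^sub>i\<^sub>,\<^sub>0\<close>; since \<open>2 i > n\<close>, the contraction splits the element reached there,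
  and the zigzag carries the splitting back to \<open>a\<close>.
\<close>


subsection \<open>Linear extension of maps on a basis\<close>

text \<open>Two mismatches shape the topological half. Singular chains are integral and ordered,
  whereas the codifferentials are real and oriented. Alternating weights compare ordered with
  oriented chains. For the coefficients, integral exactness is first strengthened to a contraction
  chosen on lists, because an identity between maps given on a basis extends to real chains, while
  mere exactness does not visibly do so. The comparison complex may have infinitely many orbits.
  Chain maps and homotopies are therefore built equivariantly on bases of simplices, and only the
  final homotopy on \<open>X\<close>, which has finitely many orbits, is turned into matrices. In
  the algebraic half, a row vector holds the coordinates of a chain in the orbit representatives, so
  module maps act by multiplication from the right. The involution exchanges rows and columns, and
  thus one exactness statement serves both directions of the double complex. The zigzag is needed
  because the contraction exists only above degree n, whereas \<open>i\<close> may be about half of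
  that: an antidiagonal step trades column degree for row degree.\<close>

definition lin :: "('a \<Rightarrow> 'b::real_vector) \<Rightarrow> ('a \<Rightarrow>\<^sub>0 real) \<Rightarrow> 'b" where
  "lin f c = (\<Sum>a\<in>Poly_Mapping.keys c. Poly_Mapping.lookup c a *\<^sub>R f a)"

lemma lookup_scaleR [simp]:
  "Poly_Mapping.lookup (r *\<^sub>R p) x = r *\<^sub>R Poly_Mapping.lookup p x"
  for p :: "'a \<Rightarrow>\<^sub>0 'b::real_vector"
proof -
  have "{i. r *\<^sub>R Poly_Mapping.lookup p i \<noteq> 0} \<subseteq> Poly_Mapping.keys p"
    by (auto simp: in_keys_iff)
  then have "finite {i. r *\<^sub>R Poly_Mapping.lookup p i \<noteq> 0}"
    using finite_keys finite_subset by blast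
  then show ?thesis
    by (simp add: scaleR_poly_mapping_def Abs_poly_mapping_inverse)
qed

lemma lin_eq_sum:
  assumes "finite A" "Poly_Mapping.keys c \<subseteq> A"
  shows "lin f c = (\<Sum>a\<in>A. Poly_Mapping.lookup c a *\<^sub>R f a)"
  unfolding lin_def
  by (rule sum.mono_neutral_left) (use assms in \<open>auto simp: in_keys_iff\<close>)

lemma linear_lin: "linear (lin f)"
proof (rule linearI)
  fix c d :: "'a \<Rightarrow>\<^sub>0 real"
  let ?A = "Poly_Mapping.keys c \<union> Poly_Mapping.keys d"
  have k: "Poly_Mapping.keys (c + d) \<subseteq> ?A"
    by (rule keys_add)
  show "lin f (c + d) = lin f c + lin f d"
    using k by (simp add: lin_eq_sum[of ?A] lookup_add scaleR_add_left sum.distrib)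
next
  fix r and c :: "'a \<Rightarrow>\<^sub>0 real"
  have k: "Poly_Mapping.keys (r *\<^sub>R c) \<subseteq> Poly_Mapping.keys c"
    by (auto simp: in_keys_iff)
  then show "lin f (r *\<^sub>R c) = r *\<^sub>R lin f c"
    by (simp add: lin_eq_sum[of "Poly_Mapping.keys c"] scaleR_sum_right)
qed

lemmas lin_simps [simp] =
  linear_0[OF linear_lin] linear_add[OF linear_lin] linear_diff[OF linear_lin]
  linear_neg[OF linear_lin] linear_cmul[OF linear_lin]

lemma lin_of_sum: "lin f (sum g A) = (\<Sum>x\<in>A. lin f (g x))"
  by (rule linear_sum[OF linear_lin])

lemma lin_single [simp]: "lin f (Poly_Mapping.single a r) = r *\<^sub>R f a"
  by (cases "r = 0") (simp_all add: lin_def)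

lemma lin_cong:
  assumes "\<And>a. a \<in> Poly_Mapping.keys c \<Longrightarrow> f a = g a"
  shows "lin f c = lin g c"
  using assms by (simp add: lin_def)

lemma linear_lin_comp:
  assumes "linear F"
  shows "F (lin f c) = lin (\<lambda>a. F (f a)) c"
  by (simp add: lin_def linear_sum[OF assms] linear_cmul[OF assms])

lemma lin_single_id [simp]: "lin (\<lambda>a. Poly_Mapping.single a 1) c = c"
proof (rule poly_mapping_eqI)
  fix k
  show "Poly_Mapping.lookup (lin (\<lambda>a. Poly_Mapping.single a 1) c) k = Poly_Mapping.lookup c k"
    by (auto simp: lin_def lookup_sum lookup_single when_def in_keys_iff if_distrib[of "(*) _"]
        sum.delta cong: if_cong)
qed

lemma lin_fun_add: "lin (\<lambda>a. f a + g a) c = lin f c + lin g c"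
  by (simp add: lin_def scaleR_add_right sum.distrib)

lemma lin_fun_diff: "lin (\<lambda>a. f a - g a) c = lin f c - lin g c"
  by (simp add: lin_def scaleR_diff_right sum_subtractf)

definition chain_space :: "'a set \<Rightarrow> ('a \<Rightarrow>\<^sub>0 real) set" where
  "chain_space A = {c. Poly_Mapping.keys c \<subseteq> A}"

lemma subspace_chain_space: "subspace (chain_space A)"
proof -
  have "Poly_Mapping.keys (x + y) \<subseteq> A"
    if "Poly_Mapping.keys x \<subseteq> A" "Poly_Mapping.keys y \<subseteq> A" for x y :: "'a \<Rightarrow>\<^sub>0 real"
    using that keys_add[of x y] by blast
  moreover have "Poly_Mapping.keys (r *\<^sub>R x) \<subseteq> Poly_Mapping.keys x" for r and x :: "'a \<Rightarrow>\<^sub>0 real"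
    by (auto simp: in_keys_iff)
  ultimately show ?thesis
    unfolding subspace_def chain_space_def by simp (meson order_trans)
qed

lemma single_in_chain_space: "a \<in> A \<Longrightarrow> Poly_Mapping.single a r \<in> chain_space A"
  by (simp add: chain_space_def)

lemma zero_in_chain_space [simp]: "0 \<in> chain_space A"
  by (simp add: chain_space_def)

lemma lin_in_subspace:
  assumes "subspace S" "\<And>a. a \<in> Poly_Mapping.keys c \<Longrightarrow> f a \<in> S"
  shows "lin f c \<in> S"
  unfolding lin_def using assms by (intro subspace_sum subspace_scale)

lemma lin_in_chain_space:
  assumes "c \<in> chain_space A" "\<And>a. a \<in> A \<Longrightarrow> f a \<in> chain_space B"
  shows "lin f c \<in> chain_space B"
  using assms by (intro lin_in_subspace[OF subspace_chain_space]) (auto simp: chain_space_def)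

lemma lin_cong_chain_space:
  assumes "c \<in> chain_space A" "\<And>a. a \<in> A \<Longrightarrow> f a = g a"
  shows "lin f c = lin g c"
  using assms by (intro lin_cong) (auto simp: chain_space_def)

subsection \<open>Ordered chains\<close>

text \<open>The formula for the boundary of a cone with apex \<open>x\<close>; it turns sign
  computations into structural induction. A single vertex has the empty list as its boundary, so the
  complex carries its augmentation.\<close>

primrec list_bd :: "'v list \<Rightarrow> ('v list \<Rightarrow>\<^sub>0 real)" where
  "list_bd [] = 0"
| "list_bd (x # xs) =
     Poly_Mapping.single xs 1 - lin (\<lambda>ys. Poly_Mapping.single (x # ys) 1) (list_bd xs)"

lemma lin_lin: "lin f (lin g c) = lin (\<lambda>a. lin f (g a)) c"
  by (rule linear_lin_comp[OF linear_lin])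

lemma scaleR_single: "r *\<^sub>R Poly_Mapping.single a s = Poly_Mapping.single a (r *\<^sub>R s)"
  by (rule poly_mapping_eqI) (simp add: lookup_single when_def)

lemma list_bd_list_bd: "lin list_bd (list_bd xs) = 0"
proof (induction xs)
  case (Cons x xs)
  \<comment> \<open>The boundary of a cone is its base minus the cone over the boundary of the base;
    the induction hypothesis removes the second term.\<close>
  have "lin list_bd (lin (\<lambda>ys. Poly_Mapping.single (x # ys) 1) c) =
      c - lin (\<lambda>ys. Poly_Mapping.single (x # ys) 1) (lin list_bd c)" for c
    by (simp add: lin_lin lin_fun_diff)
  with Cons show ?case
    by simp
qed simp

lemma list_bd_eq_sum:
  "list_bd xs = (\<Sum>j<length xs. Poly_Mapping.single (take j xs @ drop (Suc j) xs) ((-1) ^ j))"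
proof (induction xs)
  case (Cons x xs)
  have "- lin (\<lambda>ys. Poly_Mapping.single (x # ys) (1::real)) (Poly_Mapping.single ys ((-1) ^ j)) =
      Poly_Mapping.single (x # ys) ((-1) ^ Suc j)" for ys j
    by (simp add: scaleR_single flip: single_uminus)
  then have "- lin (\<lambda>ys. Poly_Mapping.single (x # ys) (1::real)) (list_bd xs) =
      (\<Sum>j<length xs. Poly_Mapping.single (x # take j xs @ drop (Suc j) xs) ((-1) ^ Suc j))"
    unfolding Cons lin_of_sum sum_negf[symmetric] by (intro sum.cong refl)
  then show ?case
    by (simp add: sum.lessThan_Suc_shift del: sum.lessThan_Suc)
qed simp

lemma keys_list_bd:
  assumes "ys \<in> Poly_Mapping.keys (list_bd xs)"
  obtains j where "j < length xs" "ys = take j xs @ drop (Suc j) xs"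
proof -
  have "Poly_Mapping.keys (list_bd xs) \<subseteq> (\<Union>j\<in>{..<length xs}. Poly_Mapping.keys
      (Poly_Mapping.single (take j xs @ drop (Suc j) xs) ((-1) ^ j :: real)))"
    unfolding list_bd_eq_sum by (rule keys_sum)
  with assms obtain j where "j < length xs"
      "ys \<in> Poly_Mapping.keys (Poly_Mapping.single (take j xs @ drop (Suc j) xs) ((-1) ^ j :: real))"
    by blast
  then show ?thesis
    using that by (auto split: if_splits)
qed

lemma list_bd_map:
  "list_bd (map f xs) = lin (\<lambda>ys. Poly_Mapping.single (map f ys) 1) (list_bd xs)"
proof (induction xs)
  case (Cons x xs)
  show ?case
    by (simp add: Cons lin_lin)
qed simp

text \<open>Adjacent transpositions generate all permutations, so this form needs no signs of
  permutations and suits recursion on the prefix \<open>us\<close>.\<close>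

definition alternating :: "('v list \<Rightarrow> 'b::real_vector) \<Rightarrow> bool" where
  "alternating A \<longleftrightarrow> (\<forall>us a b ws. A (us @ a # b # ws) = - A (us @ b # a # ws))"

lemma alternatingD: "alternating A \<Longrightarrow> A (us @ a # b # ws) = - A (us @ b # a # ws)"
  unfolding alternating_def by blast

text \<open>Swaps bring two equal entries next to each other; exchanging them then makes the value
  equal to its own negative.\<close>

lemma alternating_not_distinct:
  assumes A: "alternating A" and "\<not> distinct xs"
  shows "A xs = 0"
proof -
  obtain us vs ws y where xs: "xs = us @ [y] @ vs @ [y] @ ws"
    using not_distinct_decomp[OF assms(2)] by blast
  have "A (us @ y # vs @ y # ws) = 0"
  proof (induction vs arbitrary: us)
    case Nil
    have "2 *\<^sub>R A (us @ y # y # ws) = 0"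
      using alternatingD[OF A, of us y y ws] by (simp add: scaleR_2 eq_neg_iff_add_eq_0)
    then show ?case
      by simp
  next
    case (Cons v vs)
    have "A (us @ y # (v # vs) @ y # ws) = - A ((us @ [v]) @ y # vs @ y # ws)"
      using alternatingD[OF A, of us y v "vs @ y # ws"] by simp
    then show ?case
      using Cons.IH[of "us @ [v]"] by simp
  qed
  then show ?thesis
    by (simp add: xs)
qed

text \<open>Adjacent swaps bring the head of \<open>xs\<close> to the front of \<open>ys\<close>;
  the tails are then compared with the head held fixed, which is why the induction varies
  \<open>B\<close>.\<close>

lemma swap_invariant_mset_cong:
  assumes "\<And>us a b ws. B (us @ a # b # ws) = B (us @ b # a # ws)" and "mset xs = mset ys"
  shows "B xs = B ys"
  using assms
proof (induction xs arbitrary: B ys)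
  case (Cons x xs)
  obtain us ws where ys: "ys = us @ x # ws"
    using Cons.prems(2) by (metis list.set_intros(1) set_mset_mset split_list)
  have "B (us @ x # ws) = B (x # us @ ws)"
  proof (induction us arbitrary: ws rule: rev_induct)
    case (snoc u us)
    then show ?case
      using Cons.prems(1)[of us u x ws] snoc[of "u # ws"] by simp
  qed simp
  moreover have "B (x # xs) = B (x # us @ ws)"
  proof (rule Cons.IH[of "\<lambda>zs. B (x # zs)" "us @ ws"])
    show "B (x # us @ a # b # ws) = B (x # us @ b # a # ws)" for us a b ws
      using Cons.prems(1)[of "x # us" a b ws] by simp
    show "mset xs = mset (us @ ws)"
      using Cons.prems(2) by (simp add: ys)
  qed
  ultimately show ?case
    by (simp add: ys)
qed simp

text \<open>Swapping \<open>a\<close> and \<open>b\<close> exchanges the two faces that omit one of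
  them, and these carry opposite signs; every other face contains both and changes sign with
  \<open>A\<close>. This makes the boundary of an oriented simplex well defined.\<close>

lemma alternating_lin_list_bd:
  assumes "alternating A"
  shows "alternating (\<lambda>xs. lin A (list_bd xs))"
  unfolding alternating_def
proof (intro allI)
  fix us a b ws
  show "lin A (list_bd (us @ a # b # ws)) = - lin A (list_bd (us @ b # a # ws))"
    using assms
  proof (induction us arbitrary: A)
    case Nil
    have "A (b # a # ys) = - A (a # b # ys)" for ys
      using alternatingD[OF Nil, of "[]" b a ys] by simp
    then have "lin (\<lambda>ys. A (b # a # ys)) c = - lin (\<lambda>ys. A (a # b # ys)) c" for c
      by (simp add: lin_def sum_negf del: append_Cons)
    then show ?case
      by (simp add: lin_lin)
  next
    case (Cons u us)
    have "alternating (\<lambda>ys. A (u # ys))"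
      using Cons.prems unfolding alternating_def by (metis append_Cons)
    then show ?case
      using Cons.IH alternatingD[OF Cons.prems, of us a b ws] by (simp add: lin_lin)
  qed
qed

subsection \<open>Oriented chains of a simplicial complex\<close>

text \<open>An orientation in the form of real weights: 1 or -1 on the orderings of a face, the
  empty one included, and 0 on all other lists, so that the sign rule holds for arbitrary
  lists.\<close>

locale oriented_complex =
  fixes K :: "'v set set" and \<omega> :: "'v list \<Rightarrow> real"
  assumes complex: "abstract_simplicial_complex K"
    and alternating_\<omega>: "alternating \<omega>"
    and \<omega>_square: "\<And>xs. distinct xs \<Longrightarrow> set xs \<in> insert {} K \<Longrightarrow> \<omega> xs * \<omega> xs = 1"
    and \<omega>_outside: "\<And>xs. set xs \<notin> insert {} K \<Longrightarrow> \<omega> xs = 0"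
begin

text \<open>The degree is the number of vertices, so that the empty face carries the augmentation.\<close>

definition faces :: "nat \<Rightarrow> 'v set set" where
  "faces c = {s \<in> insert {} K. card s = c}"

definition face_lists :: "nat \<Rightarrow> 'v list set" where
  "face_lists c = {xs. set xs \<in> insert {} K \<and> length xs = c}"

definition oriented :: "'v list \<Rightarrow> ('v set \<Rightarrow>\<^sub>0 real)" where
  "oriented xs = Poly_Mapping.single (set xs) (\<omega> xs)"

text \<open>The factor \<open>\<omega> xs\<close> replaces the choice of a positive ordering: it and
  the boundary both alternate, hence every ordering yields the same chain. This also covers
  vertices, which have just one ordering.\<close>

definition bd :: "'v set \<Rightarrow> ('v set \<Rightarrow>\<^sub>0 real)" where
  "bd s = (let xs = SOME xs. distinct xs \<and> set xs = s in \<omega> xs *\<^sub>R lin oriented (list_bd xs))"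

lemma finite_face: "s \<in> insert {} K \<Longrightarrow> finite s"
  using complex by (auto simp: abstract_simplicial_complex_def)

lemma face_mono: "s \<in> insert {} K \<Longrightarrow> t \<subseteq> s \<Longrightarrow> t \<in> insert {} K"
  using complex unfolding abstract_simplicial_complex_def by blast

lemma alternating_oriented: "alternating oriented"
  unfolding alternating_def oriented_def
proof (intro allI)
  fix us a b ws
  have "\<omega> (us @ a # b # ws) = - \<omega> (us @ b # a # ws)"
    by (rule alternatingD[OF alternating_\<omega>])
  moreover have "set (us @ a # b # ws) = set (us @ b # a # ws)"
    by auto
  ultimately show "Poly_Mapping.single (set (us @ a # b # ws)) (\<omega> (us @ a # b # ws)) =
      - Poly_Mapping.single (set (us @ b # a # ws)) (\<omega> (us @ b # a # ws))"
    by (simp only: single_uminus)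
qed

lemma alternating_order_independent:
  assumes "alternating A" "distinct xs" "distinct ys" "set xs = set ys"
  shows "\<omega> xs *\<^sub>R A xs = \<omega> ys *\<^sub>R A ys"
proof (rule swap_invariant_mset_cong[of "\<lambda>xs. \<omega> xs *\<^sub>R A xs"])
  show "\<omega> (us @ a # b # ws) *\<^sub>R A (us @ a # b # ws) = \<omega> (us @ b # a # ws) *\<^sub>R A (us @ b # a # ws)"
    for us a b ws
    using alternatingD[OF assms(1), of us a b ws] alternatingD[OF alternating_\<omega>, of us a b ws]
    by simp
  show "mset xs = mset ys"
    using assms(2-4) set_eq_iff_mset_eq_distinct by blast
qed

lemma bd_set:
  assumes "distinct xs"
  shows "bd (set xs) = \<omega> xs *\<^sub>R lin oriented (list_bd xs)"
proof -
  define ys where "ys = (SOME ys. distinct ys \<and> set ys = set xs)"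
  have "distinct ys \<and> set ys = set xs"
    unfolding ys_def by (rule someI[of _ xs]) (use assms in simp)
  then have "\<omega> ys *\<^sub>R lin oriented (list_bd ys) = \<omega> xs *\<^sub>R lin oriented (list_bd xs)"
    using alternating_order_independent[OF alternating_lin_list_bd[OF alternating_oriented], of ys xs]
      assms by simp
  then show ?thesis
    by (simp add: bd_def ys_def[symmetric])
qed

text \<open>Lists with repetitions cause no exception, since alternation makes both sides vanish
  there. Thus \<open>oriented\<close> is a chain map on all ordered chains, degenerate lists
  included.\<close>

lemma lin_bd_oriented:
  assumes "set xs \<in> insert {} K"
  shows "lin bd (oriented xs) = lin oriented (list_bd xs)"
proof (cases "distinct xs")
  case True
  then show ?thesis
    using \<omega>_square[OF True assms] by (simp add: oriented_def bd_set)
next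
  case False
  then show ?thesis
    using alternating_not_distinct[OF alternating_lin_list_bd[OF alternating_oriented] False]
      alternating_not_distinct[OF alternating_\<omega> False]
    by (simp add: oriented_def)
qed

lemma lin_bd_lin_oriented:
  assumes "c \<in> chain_space (face_lists n)"
  shows "lin bd (lin oriented c) = lin oriented (lin list_bd c)"
  unfolding lin_lin
  by (rule lin_cong_chain_space[OF assms]) (simp add: face_lists_def lin_bd_oriented)

lemma list_bd_in_chain_space:
  assumes "xs \<in> face_lists (Suc n)"
  shows "list_bd xs \<in> chain_space (face_lists n)"
  unfolding chain_space_def
proof clarify
  fix ys
  assume "ys \<in> Poly_Mapping.keys (list_bd xs)"
  then obtain j where j: "j < length xs" "ys = take j xs @ drop (Suc j) xs"
    by (rule keys_list_bd)
  then have "set ys \<subseteq> set xs"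
    using set_take_subset set_drop_subset by fastforce
  then show "ys \<in> face_lists n"
    using assms j face_mono[of "set xs" "set ys"] by (auto simp: face_lists_def)
qed

lemma oriented_in_chain_space:
  assumes "xs \<in> face_lists n"
  shows "oriented xs \<in> chain_space (faces n)"
proof (cases "distinct xs")
  case True
  then show ?thesis
    using assms by (auto simp: oriented_def face_lists_def faces_def distinct_card intro!: single_in_chain_space)
next
  case False
  then show ?thesis
    using alternating_not_distinct[OF alternating_oriented False] by simp
qed

lemma faces_ordering:
  assumes "s \<in> faces n"
  obtains xs where "distinct xs" "set xs = s" "xs \<in> face_lists n"
proof -
  have "s \<in> insert {} K" "card s = n"
    using assms by (auto simp: faces_def)
  moreover obtain xs where "distinct xs" "set xs = s"
    using finite_distinct_list finite_face calculation(1) by blast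
  ultimately show ?thesis
    using that[of xs] by (auto simp: face_lists_def distinct_card)
qed

lemma bd_in_chain_space:
  assumes "s \<in> faces (Suc n)"
  shows "bd s \<in> chain_space (faces n)"
proof -
  obtain xs where xs: "distinct xs" "set xs = s" "xs \<in> face_lists (Suc n)"
    using assms by (rule faces_ordering)
  have "lin oriented (list_bd xs) \<in> chain_space (faces n)"
    using list_bd_in_chain_space[OF xs(3)] oriented_in_chain_space by (rule lin_in_chain_space)
  then show ?thesis
    using bd_set[OF xs(1)] xs(2) subspace_chain_space subspace_scale by fastforce
qed

lemma bd_empty [simp]: "bd {} = 0"
  using bd_set[of "[]"] by simp

lemma bd_bd:
  assumes "s \<in> faces n"
  shows "lin bd (bd s) = 0"
proof (cases n)
  case 0
  then have "s = {}"
    using assms finite_face by (auto simp: faces_def)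
  then show ?thesis
    by simp
next
  case (Suc m)
  then obtain xs where xs: "distinct xs" "set xs = s" "xs \<in> face_lists (Suc m)"
    using assms by (auto elim: faces_ordering)
  have "lin bd (bd s) = \<omega> xs *\<^sub>R lin bd (lin oriented (list_bd xs))"
    using bd_set[OF xs(1)] xs(2) by simp
  also have "lin bd (lin oriented (list_bd xs)) = 0"
    using lin_bd_lin_oriented[OF list_bd_in_chain_space[OF xs(3)]]
    by (simp add: list_bd_list_bd)
  finally show ?thesis
    by simp
qed

lemma bd_image:
  assumes "s \<in> insert {} K" and inj: "inj_on f s"
    and \<omega>: "\<And>xs. set xs \<subseteq> s \<Longrightarrow> \<omega> (map f xs) = \<omega> xs"
  shows "bd (f ` s) = lin (\<lambda>t. Poly_Mapping.single (f ` t) 1) (bd s)"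
proof -
  obtain xs where xs: "distinct xs" "set xs = s"
    using finite_distinct_list finite_face assms(1) by blast
  have "bd (f ` s) = \<omega> (map f xs) *\<^sub>R lin oriented (list_bd (map f xs))"
    using bd_set[of "map f xs"] xs inj by (simp add: distinct_map)
  also have "lin oriented (list_bd (map f xs)) = lin (\<lambda>ys. oriented (map f ys)) (list_bd xs)"
    by (simp add: list_bd_map lin_lin)
  also have "\<dots> = lin (\<lambda>ys. lin (\<lambda>t. Poly_Mapping.single (f ` t) 1) (oriented ys)) (list_bd xs)"
  proof (rule lin_cong)
    fix ys
    assume "ys \<in> Poly_Mapping.keys (list_bd xs)"
    then obtain j where "j < length xs" "ys = take j xs @ drop (Suc j) xs"
      by (rule keys_list_bd)
    then have "set ys \<subseteq> s"
      using set_take_subset set_drop_subset xs(2) by fastforce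
    then show "oriented (map f ys) = lin (\<lambda>t. Poly_Mapping.single (f ` t) 1) (oriented ys)"
      by (simp add: oriented_def \<omega> scaleR_single)
  qed
  also have "\<omega> (map f xs) = \<omega> xs"
    using \<omega> xs(2) by simp
  finally show ?thesis
    using bd_set[OF xs(1)] xs(2) by (simp add: lin_lin)
qed

lemma sorted_wrt_list_bd:
  assumes "sorted_wrt P xs" "ys \<in> Poly_Mapping.keys (list_bd xs)"
  shows "sorted_wrt P ys"
proof -
  obtain j where j: "j < length xs" "ys = take j xs @ drop (Suc j) xs"
    using assms(2) by (rule keys_list_bd)
  have "sorted_wrt P (take j xs @ xs ! j # drop (Suc j) xs)"
    using assms(1) id_take_nth_drop[OF j(1)] by simp
  then show ?thesis
    by (simp add: j(2) sorted_wrt_append)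
qed

text \<open>Sorting the vertices embeds the oriented chains into the ordered ones.\<close>

lemma exact_if_face_lists_exact:
  assumes exact: "\<And>z. z \<in> chain_space (face_lists n) \<Longrightarrow> lin list_bd z = 0 \<Longrightarrow>
      \<exists>y\<in>chain_space (face_lists (Suc n)). lin list_bd y = z"
    and z: "z \<in> chain_space (faces n)" "lin bd z = 0"
  shows "\<exists>y\<in>chain_space (faces (Suc n)). lin bd y = z"
proof -
  define V where "V = \<Union>(Poly_Mapping.keys z)"
  have face: "s \<in> insert {} K" if "s \<in> Poly_Mapping.keys z" for s
    using that z(1) by (auto simp: chain_space_def faces_def)
  then have "finite V"
    unfolding V_def using finite_face by (intro finite_Union) auto
  \<comment> \<open>The support of \<open>z\<close> is finite, so a numbering of its vertices
    suffices and no order on all vertices has to be chosen.\<close>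
  then obtain r :: "'v \<Rightarrow> nat" where r: "inj_on r V"
    using finite_imp_inj_to_nat_seg by meson
  define S where "S s = map (inv_into V r) (sorted_list_of_set (r ` s))" for s
  define \<iota> where "\<iota> s = Poly_Mapping.single (S s) (\<omega> (S s))" for s
  have S: "distinct (S s)" "set (S s) = s" "sorted_wrt (\<lambda>x y. r x < r y) (S s)"
    if s: "s \<subseteq> V" for s
  proof -
    have fin: "finite (r ` s)"
      using \<open>finite V\<close> s finite_subset by blast
    have inv: "map r (S s) = sorted_list_of_set (r ` s)"
      unfolding S_def map_map using fin s by (intro map_idI) (auto simp: f_inv_into_f)
    have "sorted_wrt (<) (map r (S s))"
      unfolding inv by simp
    then show "sorted_wrt (\<lambda>x y. r x < r y) (S s)"
      by (simp add: sorted_wrt_map)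
    show "distinct (S s)"
      using inv distinct_sorted_list_of_set[of "r ` s"] distinct_map by metis
    show "set (S s) = s"
      unfolding S_def using fin s r by (auto simp: image_image inv_into_f_f subset_iff image_iff)
  qed
  have S_unique: "S (set xs) = xs" if xs: "set xs \<subseteq> V" "sorted_wrt (\<lambda>x y. r x < r y) xs" for xs
  proof -
    have "sorted_wrt (<) (map r xs)"
      using xs(2) by (simp add: sorted_wrt_map)
    then have "sorted_list_of_set (r ` set xs) = map r xs"
      using sorted_list_of_set.idem_if_sorted_distinct[of "map r xs"] by (simp add: strict_sorted_iff)
    then show ?thesis
      using xs(1) r unfolding S_def by (auto intro!: map_idI simp: subset_iff)
  qed
  \<comment> \<open>Omitting an entry keeps an increasing list increasing, so each face is already
    the sorted list of its vertices and its two signs cancel.\<close>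
  have \<iota>_bd: "lin \<iota> (bd s) = lin list_bd (\<iota> s)" if s: "s \<in> Poly_Mapping.keys z" for s
  proof -
    have V: "s \<subseteq> V"
      using s by (auto simp: V_def)
    have "lin \<iota> (oriented ys) = Poly_Mapping.single ys 1" if ys: "ys \<in> Poly_Mapping.keys (list_bd (S s))" for ys
    proof -
      have sorted: "sorted_wrt (\<lambda>x y. r x < r y) ys"
        using S(3)[OF V] ys by (rule sorted_wrt_list_bd)
      obtain j where "j < length (S s)" "ys = take j (S s) @ drop (Suc j) (S s)"
        using ys by (rule keys_list_bd)
      then have sub: "set ys \<subseteq> s"
        using set_take_subset set_drop_subset S(2)[OF V] by fastforce
      then have S_ys: "S (set ys) = ys"
        using V S_unique sorted by blast
      then have "distinct ys"
        using S(1)[of "set ys"] sub V by simp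
      then have "\<omega> ys * \<omega> ys = 1"
        using \<omega>_square face_mono[OF face[OF s] sub] by blast
      then show ?thesis
        by (simp add: oriented_def \<iota>_def S_ys scaleR_single)
    qed
    then have "lin \<iota> (lin oriented (list_bd (S s))) = lin (\<lambda>ys. Poly_Mapping.single ys 1) (list_bd (S s))"
      unfolding lin_lin by (rule lin_cong)
    then show ?thesis
      using bd_set[OF S(1)[OF V]] S(2)[OF V] by (simp add: \<iota>_def)
  qed
  have "lin list_bd (lin \<iota> z) = lin \<iota> (lin bd z)"
    unfolding lin_lin by (rule lin_cong) (simp add: \<iota>_bd)
  then have "lin list_bd (lin \<iota> z) = 0"
    by (simp add: z(2))
  moreover have "lin \<iota> z \<in> chain_space (face_lists n)"
  proof (rule lin_in_subspace[OF subspace_chain_space])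
    fix s
    assume s: "s \<in> Poly_Mapping.keys z"
    then have V: "s \<subseteq> V"
      by (auto simp: V_def)
    have "card s = n"
      using s z(1) by (auto simp: chain_space_def faces_def)
    then have "S s \<in> face_lists n"
      using S(1,2)[OF V] face[OF s] distinct_card[of "S s"] by (auto simp: face_lists_def)
    then show "\<iota> s \<in> chain_space (face_lists n)"
      unfolding \<iota>_def by (rule single_in_chain_space)
  qed
  ultimately obtain y where y: "y \<in> chain_space (face_lists (Suc n))" "lin list_bd y = lin \<iota> z"
    using exact by blast
  \<comment> \<open>Sorting followed by \<open>oriented\<close> is the identity, as the sign of the
    sorted list occurs twice. Hence the image of the bounding ordered chain bounds
    \<open>z\<close>.\<close>
  have "lin oriented (\<iota> s) = Poly_Mapping.single s 1" if s: "s \<in> Poly_Mapping.keys z" for s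
  proof -
    have V: "s \<subseteq> V"
      using s by (auto simp: V_def)
    show ?thesis
      using \<omega>_square[OF S(1)[OF V]] S(2)[OF V] face[OF s]
      by (simp add: \<iota>_def oriented_def scaleR_single)
  qed
  then have "lin oriented (lin \<iota> z) = lin (\<lambda>s. Poly_Mapping.single s 1) z"
    unfolding lin_lin by (rule lin_cong)
  then have "lin bd (lin oriented y) = z"
    using lin_bd_lin_oriented[OF y(1)] y(2) by simp
  moreover have "lin oriented y \<in> chain_space (faces (Suc n))"
    using y(1) oriented_in_chain_space by (rule lin_in_chain_space)
  ultimately show ?thesis
    by blast
qed

end

subsection \<open>Integral chains and contractible spaces\<close>

lemma frag_extend_frag_extend:
  "frag_extend f (frag_extend g c) = frag_extend (\<lambda>a. frag_extend f (g a)) c"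
  using subset_UNIV by (induction c rule: frag_induction) (auto simp: frag_extend_diff)

lemma frag_extend_fun_diff: "frag_extend (\<lambda>a. f a - g a) c = frag_extend f c - frag_extend g c"
  using subset_UNIV by (induction c rule: frag_induction) (auto simp: frag_extend_diff)

lemma keys_frag_extend_subset:
  assumes "Poly_Mapping.keys c \<subseteq> A" "\<And>a. a \<in> A \<Longrightarrow> Poly_Mapping.keys (f a) \<subseteq> B"
  shows "Poly_Mapping.keys (frag_extend f c) \<subseteq> B"
  using keys_frag_extend[of f c] assms by blast

lemma keys_diff_subset:
  "Poly_Mapping.keys c \<subseteq> A \<Longrightarrow> Poly_Mapping.keys d \<subseteq> A \<Longrightarrow> Poly_Mapping.keys (c - d) \<subseteq> A"
  using keys_diff[of c d] by blast

lemma frag_extend_frag_of [simp]: "frag_extend frag_of c = c"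
  by (rule frag_expansion[symmetric])

abbreviation list_cone :: "'v \<Rightarrow> ('v list \<Rightarrow>\<^sub>0 int) \<Rightarrow> ('v list \<Rightarrow>\<^sub>0 int)" where
  "list_cone x \<equiv> frag_extend (\<lambda>ys. frag_of (x # ys))"

text \<open>Singular chains have integer coefficients here, hence this integral twin of
  \<open>list_bd\<close>; \<open>realify\<close> relates the two.\<close>

primrec frag_list_bd :: "'v list \<Rightarrow> ('v list \<Rightarrow>\<^sub>0 int)" where
  "frag_list_bd [] = 0"
| "frag_list_bd (x # xs) = frag_of xs - list_cone x (frag_list_bd xs)"

lemma frag_list_bd_list_cone:
  "frag_extend frag_list_bd (list_cone x c) = c - list_cone x (frag_extend frag_list_bd c)"
  by (simp add: frag_extend_frag_extend frag_extend_fun_diff)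

lemma frag_list_bd_frag_list_bd: "frag_extend frag_list_bd (frag_list_bd xs) = 0"
proof (induction xs)
  case (Cons x xs)
  then show ?case
    by (simp add: frag_extend_diff frag_list_bd_list_cone)
qed simp

lemma frag_list_bd_eq_sum:
  "frag_list_bd xs = (\<Sum>j<length xs. frag_cmul ((-1) ^ j) (frag_of (take j xs @ drop (Suc j) xs)))"
proof (induction xs)
  case (Cons x xs)
  have "- list_cone x (frag_list_bd xs) =
      (\<Sum>j<length xs. frag_cmul ((-1) ^ Suc j) (frag_of (x # take j xs @ drop (Suc j) xs)))"
    unfolding Cons frag_extend_sum[OF finite_lessThan] sum_negf[symmetric] o_def frag_extend_cmul
    by (intro sum.cong refl) simp
  then show ?case
    by (simp add: sum.lessThan_Suc_shift del: sum.lessThan_Suc)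
qed simp

lemma keys_frag_list_bd:
  "Poly_Mapping.keys (frag_list_bd xs) \<subseteq> (\<lambda>j. take j xs @ drop (Suc j) xs) ` {..<length xs}"
  unfolding frag_list_bd_eq_sum by (rule order_trans[OF keys_sum]) (auto simp: keys_frag_of)

lemma set_take_drop_Suc: "set (take j xs @ drop (Suc j) xs) \<subseteq> set xs"
  using set_take_subset[of j xs] set_drop_subset[of "Suc j" xs] by simp

lemma keys_frag_list_bd_subset:
  "Poly_Mapping.keys (frag_list_bd xs) \<subseteq> {ys. set ys \<subseteq> set xs \<and> Suc (length ys) = length xs}"
  using keys_frag_list_bd[of xs] set_take_drop_Suc[of _ xs] by force

lemma nth_take_drop_Suc:
  assumes "i < length xs" "Suc j < length xs"
  shows "(take i xs @ drop (Suc i) xs) ! j = xs ! (if j < i then j else Suc j)"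
  using assms by (auto simp: nth_append min_def)

text \<open>The identity is homotopic to a constant map, so \<open>c\<close> is homologous to its
  image at one point, and a point has no homology in positive degree. In degree 0 that image is the
  augmentation of \<open>c\<close> times a point simplex, and the last hypothesis makes it
  vanish.\<close>

lemma contractible_cycle_is_boundary:
  fixes X :: "'a topology"
  assumes "contractible_space X" and c: "singular_chain p X c" "chain_boundary p c = 0"
    and 0: "p = 0 \<Longrightarrow> (\<And>a::'a. chain_map p (\<lambda>x. a) c = 0)"
  shows "\<exists>d. singular_chain (Suc p) X d \<and> chain_boundary (Suc p) d = c"
proof (cases "topspace X = {}")
  case True
  then have "c = 0"
    using c(1) singular_chain_empty by blast
  then show ?thesis
    by (intro exI[of _ 0]) simp
next
  case False
  obtain a where h: "homotopic_with (\<lambda>x. True) X X id (\<lambda>x. a)"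
    using assms(1) by (auto simp: contractible_space_def)
  have a: "a \<in> topspace X"
    using homotopic_with_imp_continuous_maps[OF h] False by (auto simp: continuous_map_def Pi_iff)
  have cycle: "singular_relcycle p X {} c"
    using c by (simp add: singular_cycle)
  have "homologous_rel p X {} (chain_map p id c) (chain_map p (\<lambda>x. a) c)"
    by (rule homotopic_imp_homologous_rel_chain_maps[where S = X and T = "{}"])
      (use h cycle in simp_all)
  then have rel: "singular_relboundary p X {} (c - chain_map p (\<lambda>x. a) c)"
    using c(1) by (simp add: homologous_rel_def chain_map_ident)
  have bdry: "singular_relboundary p X {} (chain_map p (\<lambda>x. a) c)"
  proof (cases "p = 0")
    case True
    then show ?thesis
      using 0 by (auto simp: singular_boundary intro!: exI[of _ 0])
  next
    case False
    have "singular_relcycle p (subtopology X {a}) {} (chain_map p (\<lambda>x. a) c)"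
      using cycle by (rule singular_relcycle_chain_map) (use a in auto)
    then have "singular_relboundary p (subtopology X {a}) {} (chain_map p (\<lambda>x. a) c)"
      using singular_boundary_eq_cycle_singleton[of "subtopology X {a}" a p] a False by auto
    then show ?thesis
      using singular_boundary_mono[of "{a}" UNIV] by simp
  qed
  have "singular_relboundary p X {} c"
    using singular_relboundary_add[OF rel bdry] by simp
  then show ?thesis
    by (simp add: singular_boundary)
qed

subsection \<open>Realization and singular simplices\<close>

lemma topspace_realization_topology: "topspace (realization_topology K) = realization K"
proof -
  have "realization K \<inter> closed_simplex s = closed_simplex s" if "s \<in> K" for s
    using that by (auto simp: realization_def)
  then have "openin (realization_topology K) (realization K)"
    by (simp add: openin_realization_topology)
  moreover have "topspace (realization_topology K) \<subseteq> realization K"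
    using openin_topspace[of "realization_topology K"] unfolding openin_realization_topology ..
  ultimately show ?thesis
    using openin_subset by blast
qed

lemma continuous_map_closed_simplex:
  assumes "s \<in> K"
  shows "continuous_map (top_of_set (closed_simplex s)) (realization_topology K) (\<lambda>x. x)"
proof -
  have "closed_simplex s \<subseteq> realization K"
    using assms by (auto simp: realization_def)
  moreover have "{x \<in> closed_simplex s. x \<in> U} = U \<inter> closed_simplex s" for U
    by auto
  ultimately show ?thesis
    using assms by (auto simp: continuous_map_def topspace_realization_topology openin_realization_topology)
qed

text \<open>The singular simplices that are small enough to be replaced by simplices of \<open>s\<close> are those in
  the set of points whose largest barycentric coordinates are attained in \<open>s\<close> only.\<close>

definition dominated_by :: "'v set set \<Rightarrow> 'v set \<Rightarrow> ('v \<Rightarrow> real) set" where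
  "dominated_by K s = {x \<in> realization K. \<exists>v\<in>s. 0 < x v \<and> (\<forall>w. w \<notin> s \<longrightarrow> x w < x v)}"

definition dominant_vertex :: "('v \<Rightarrow> real) \<Rightarrow> 'v" where
  "dominant_vertex x = (SOME v. \<forall>w. x w \<le> x v)"

lemma closed_simplex_max:
  assumes "finite s" "x \<in> closed_simplex s"
  obtains v where "v \<in> s" "0 < x v" "\<And>w. x w \<le> x v"
proof -
  have x: "\<And>v. 0 \<le> x v" "\<And>v. v \<notin> s \<Longrightarrow> x v = 0" "sum x s = 1"
    using assms(2) by (auto simp: closed_simplex_def)
  have "s \<noteq> {}"
    using x(3) by auto
  then have "Max (x ` s) \<in> x ` s"
    using assms(1) by (intro Max_in) auto
  then obtain v where "v \<in> s" "x v = Max (x ` s)"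
    by auto
  then have v: "v \<in> s" "\<And>w. w \<in> s \<Longrightarrow> x w \<le> x v"
    using assms(1) by simp_all
  have le: "x w \<le> x v" for w
    using v(2) x by (cases "w \<in> s") auto
  have "x v \<noteq> 0"
  proof
    assume "x v = 0"
    then have "sum x s = 0"
      using le x(1) by (intro sum.neutral) (metis antisym)
    then show False
      using x(3) by simp
  qed
  then show ?thesis
    using that[of v] v(1) le x(1)[of v] by (simp add: order_less_le)
qed

lemma dominant_vertex_max:
  assumes "finite s" "x \<in> closed_simplex s"
  shows "x w \<le> x (dominant_vertex x)"
proof -
  have "\<exists>v. \<forall>w. x w \<le> x v"
    using closed_simplex_max[OF assms] by metis
  then have "\<forall>w. x w \<le> x (dominant_vertex x)"
    unfolding dominant_vertex_def by (rule someI_ex)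
  then show ?thesis ..
qed

lemma dominant_vertex_in:
  assumes "finite s" "x \<in> closed_simplex s"
  shows "dominant_vertex x \<in> s"
proof (rule ccontr)
  assume "dominant_vertex x \<notin> s"
  then have "x (dominant_vertex x) = 0"
    using assms(2) by (auto simp: closed_simplex_def)
  moreover obtain v where "0 < x v"
    using closed_simplex_max[OF assms] by metis
  ultimately show False
    using dominant_vertex_max[OF assms, of v] by simp
qed

section \<open>The open cover by dominated sets\<close>

context
  fixes K :: "'v set set"
  assumes K: "abstract_simplicial_complex K"
begin

lemma finite_simplex: "s \<in> K \<Longrightarrow> finite s" and simplex_nonempty: "s \<in> K \<Longrightarrow> s \<noteq> {}"
  and simplex_mono: "s \<in> K \<Longrightarrow> t \<subseteq> s \<Longrightarrow> t \<noteq> {} \<Longrightarrow> t \<in> K"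
  using K unfolding abstract_simplicial_complex_def by blast+

lemma dominant_vertex_in_dominated_by:
  assumes "x \<in> dominated_by K s"
  shows "dominant_vertex x \<in> s"
proof (rule ccontr)
  assume "dominant_vertex x \<notin> s"
  then obtain v where "x (dominant_vertex x) < x v"
    using assms by (auto simp: dominated_by_def)
  moreover obtain t where "t \<in> K" "x \<in> closed_simplex t"
    using assms by (auto simp: dominated_by_def realization_def)
  ultimately show False
    using dominant_vertex_max[OF finite_simplex, of t x v] by simp
qed

text \<open>On a closed simplex \<open>t\<close> the coordinates outside \<open>t\<close> vanish,
  and the clause \<open>0 < x v\<close> of the definition settles them all at once. What remains is
  finitely many strict inequalities.\<close>

lemma openin_dominated_by: "openin (realization_topology K) (dominated_by K s)"
  unfolding openin_realization_topology
proof (intro conjI ballI)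
  fix t
  assume t: "t \<in> K"
  define U where "U v = {x :: 'v \<Rightarrow> real. 0 < x v} \<inter> (\<Inter>w\<in>t - s. {x. x w < x v})" for v
  have coord: "continuous_on UNIV (\<lambda>x :: 'v \<Rightarrow> real. x v)" for v
    by (rule continuous_on_product_coordinates)
  have "open (U v)" for v
    unfolding U_def using finite_simplex[OF t]
    by (intro open_Int open_INT ballI open_Collect_less coord continuous_on_const) auto
  then have "open (\<Union>v\<in>s. U v)"
    by blast
  moreover have "dominated_by K s \<inter> closed_simplex t = closed_simplex t \<inter> (\<Union>v\<in>s. U v)"
  proof -
    have "x \<in> dominated_by K s \<longleftrightarrow> x \<in> (\<Union>v\<in>s. U v)" if x: "x \<in> closed_simplex t" for x
    proof -
      have "(\<forall>w. w \<notin> s \<longrightarrow> x w < x v) \<longleftrightarrow> (\<forall>w\<in>t - s. x w < x v)" if "0 < x v" for v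
        using that x unfolding closed_simplex_def by force
      moreover have "x \<in> realization K"
        using x t by (auto simp: realization_def)
      ultimately show ?thesis
        unfolding dominated_by_def U_def by blast
    qed
    then show ?thesis
      by blast
  qed
  ultimately show "openin (top_of_set (closed_simplex t)) (dominated_by K s \<inter> closed_simplex t)"
    by (auto simp: openin_open)
qed (auto simp: dominated_by_def)

lemma closed_simplex_subset_dominated_by:
  assumes "s \<in> K"
  shows "closed_simplex s \<subseteq> dominated_by K s"
proof
  fix x
  assume x: "x \<in> closed_simplex s"
  then obtain v where v: "v \<in> s" "0 < x v"
    using closed_simplex_max finite_simplex assms by metis
  moreover have "x w = 0" if "w \<notin> s" for w
    using x that by (simp add: closed_simplex_def)
  ultimately show "x \<in> dominated_by K s"
    using x assms by (auto simp: dominated_by_def realization_def)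
qed

end

section \<open>Vertex lists of singular simplices and affine simplices of lists\<close>

definition vertex_list :: "nat \<Rightarrow> ((nat \<Rightarrow> real) \<Rightarrow> ('v \<Rightarrow> real)) \<Rightarrow> 'v list" where
  "vertex_list p f = map (\<lambda>k. dominant_vertex (f (\<lambda>i. if i = k then 1 else 0))) [0..<Suc p]"

lemma length_vertex_list [simp]: "length (vertex_list p f) = Suc p"
  by (simp add: vertex_list_def)

lemma set_vertex_list_subset:
  assumes "\<And>x. x \<in> standard_simplex p \<Longrightarrow> dominant_vertex (f x) \<in> s"
  shows "set (vertex_list p f) \<subseteq> s"
proof -
  have "(\<lambda>i. if i = k then 1 else 0) \<in> standard_simplex p" if "k \<le> p" for k
    using that by simp
  then show ?thesis
    using assms by (auto simp: vertex_list_def)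
qed

text \<open>Corner \<open>j\<close> of the face opposite to corner \<open>k\<close> is corner
  \<open>j\<close> or \<open>Suc j\<close> of the whole simplex, depending on whether it comes
  before \<open>k\<close>. This compatibility is what makes reading off vertices a chain
  map.\<close>

lemma vertex_list_singular_face:
  assumes "1 \<le> p" "k \<le> p"
  shows "vertex_list (p - 1) (singular_face p k f) =
    take k (vertex_list p f) @ drop (Suc k) (vertex_list p f)" (is "?l = ?r")
proof (rule nth_equalityI)
  show "length ?l = length ?r"
    using assms by simp
  fix j
  assume "j < length ?l"
  then have j: "j < p"
    using assms by simp
  have face: "simplical_face k (\<lambda>i. if i = j then 1 else (0::real)) =
      (\<lambda>i. if i = (if j < k then j else Suc j) then 1 else 0)"
    by (rule ext) (auto simp: simplical_face_def)
  have "(\<lambda>i. if i = j then 1 else 0) \<in> standard_simplex (p - 1)"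
    using j by simp
  then have "?l ! j = dominant_vertex (f (\<lambda>i. if i = (if j < k then j else Suc j) then 1 else 0))"
    using j unfolding vertex_list_def singular_face_def by (simp add: face del: upt_Suc)
  also have "\<dots> = vertex_list p f ! (if j < k then j else Suc j)"
    using j unfolding vertex_list_def by (simp del: upt_Suc)
  also have "\<dots> = ?r ! j"
    using j assms by (subst nth_take_drop_Suc) auto
  finally show "?l ! j = ?r ! j" .
qed

text \<open>Repeated vertices are allowed and their coordinates add up. The restriction is there
  because singular simplices are extensional functions on the standard simplex.\<close>

definition affine_simplex :: "'v list \<Rightarrow> (nat \<Rightarrow> real) \<Rightarrow> ('v \<Rightarrow> real)" where
  "affine_simplex xs =
     restrict (\<lambda>t v. \<Sum>j<length xs. if xs ! j = v then t j else 0) (standard_simplex (length xs - 1))"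

lemma affine_simplex_in_closed_simplex:
  assumes "xs \<noteq> []" "t \<in> standard_simplex (length xs - 1)"
  shows "affine_simplex xs t \<in> closed_simplex (set xs)"
proof -
  have t: "\<And>i. 0 \<le> t i" "(\<Sum>i\<le>length xs - 1. t i) = 1"
    using assms(2) by (auto simp: standard_simplex_def)
  have "{..length xs - 1} = {..<length xs}"
    using assms(1) by (metis One_nat_def Suc_pred length_greater_0_conv lessThan_Suc_atMost)
  then have "(\<Sum>j<length xs. t j) = 1"
    using t(2) by simp
  moreover have "(\<Sum>v\<in>set xs. \<Sum>j<length xs. if xs ! j = v then t j else 0) = (\<Sum>j<length xs. t j)"
    by (subst sum.swap) (simp add: sum.delta)
  ultimately show ?thesis
    using assms(2) t(1) by (auto simp: affine_simplex_def closed_simplex_def intro!: sum_nonneg sum.neutral)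
qed

lemma singular_simplex_affine_simplex:
  assumes "length xs = Suc p"
  shows "singular_simplex p (top_of_set (closed_simplex (set xs))) (affine_simplex xs)"
proof -
  have [simp]: "length xs - Suc 0 = p" "xs \<noteq> []"
    using assms by auto
  let ?D = "subtopology (powertop_real UNIV) (standard_simplex p)"
  have "continuous_map ?D euclidean (\<lambda>t v. \<Sum>j<length xs. if xs ! j = v then t j else 0)"
    unfolding euclidean_product_topology[symmetric] continuous_map_componentwise_UNIV
  proof
    fix v
    have "continuous_map ?D euclideanreal (\<lambda>t. if xs ! j = v then t j else 0)" for j
      by (auto intro: continuous_map_from_subtopology continuous_map_product_projection)
    then show "continuous_map ?D euclideanreal (\<lambda>t. \<Sum>j<length xs. if xs ! j = v then t j else 0)"
      by (intro continuous_map_sum) auto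
  qed
  then have "continuous_map ?D euclidean (affine_simplex xs)"
    by (rule continuous_map_eq) (simp add: affine_simplex_def topspace_standard_simplex)
  then show ?thesis
    using affine_simplex_in_closed_simplex[of xs]
    by (auto simp: singular_simplex_def continuous_map_in_subtopology affine_simplex_def
        topspace_standard_simplex)
qed

lemma sum_skip:
  fixes h :: "nat \<Rightarrow> real"
  assumes "k \<le> p"
  shows "(\<Sum>j<Suc p. h j) = h k + (\<Sum>j<p. h (if j < k then j else Suc j))"
proof -
  have "bij_betw (\<lambda>j. if j < k then j else Suc j) {..<p} ({..<Suc p} - {k})"
    by (rule bij_betwI[where g = "\<lambda>j. if j < k then j else j - 1"]) (use assms in \<open>auto split: if_splits\<close>)
  then have "(\<Sum>j\<in>{..<Suc p} - {k}. h j) = (\<Sum>j<p. h (if j < k then j else Suc j))"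
    by (rule sum.reindex_bij_betw[symmetric])
  then show ?thesis
    using assms sum.remove[of "{..<Suc p}" k h] by simp
qed

lemma singular_face_affine_simplex:
  assumes len: "length xs = Suc p" and "1 \<le> p" "k \<le> p"
  shows "singular_face p k (affine_simplex xs) = affine_simplex (take k xs @ drop (Suc k) xs)"
proof -
  let ?ys = "take k xs @ drop (Suc k) xs"
  have ys: "length ?ys = p"
    using assms by simp
  have *: "affine_simplex xs (simplical_face k t) v = affine_simplex ?ys t v"
    if t: "t \<in> standard_simplex (p - 1)" for t v
  proof -
    have face: "simplical_face k t \<in> standard_simplex p"
      using simplical_face_in_standard_simplex assms t by simp
    have "affine_simplex xs (simplical_face k t) v =
        (\<Sum>j<Suc p. if xs ! j = v then simplical_face k t j else 0)"
      using face len by (simp add: affine_simplex_def del: sum.lessThan_Suc)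
    also have "\<dots> = (if xs ! k = v then simplical_face k t k else 0) +
        (\<Sum>j<p. if xs ! (if j < k then j else Suc j) = v
           then simplical_face k t (if j < k then j else Suc j) else 0)"
      by (rule sum_skip[OF assms(3)])
    also have "\<dots> = (\<Sum>j<p. if ?ys ! j = v then t j else 0)"
    proof -
      have "?ys ! j = xs ! (if j < k then j else Suc j)" if "j < p" for j
        using that assms by (intro nth_take_drop_Suc) auto
      moreover have "simplical_face k t (if j < k then j else Suc j) = t j" "simplical_face k t k = 0" for j
        by (simp_all add: simplical_face_def)
      ultimately show ?thesis
        by (simp cong: if_cong)
    qed
    also have "\<dots> = affine_simplex ?ys t v"
      using t ys by (simp add: affine_simplex_def)
    finally show ?thesis .
  qed
  have "restrict (affine_simplex xs \<circ> simplical_face k) (standard_simplex (p - Suc 0)) t =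
      affine_simplex ?ys t" for t
  proof (cases "t \<in> standard_simplex (p - 1)")
    case True
    with * show ?thesis
      by (simp add: fun_eq_iff)
  next
    case False
    then show ?thesis
      unfolding affine_simplex_def ys by simp
  qed
  then show ?thesis
    unfolding singular_face_def by blast
qed

section \<open>Chain maps between ordered and singular chains\<close>

definition vertex_chain :: "nat \<Rightarrow> (((nat \<Rightarrow> real) \<Rightarrow> ('v \<Rightarrow> real)) \<Rightarrow>\<^sub>0 int) \<Rightarrow> ('v list \<Rightarrow>\<^sub>0 int)" where
  "vertex_chain p = frag_extend (\<lambda>f. frag_of (vertex_list p f))"

definition affine_chain :: "('v list \<Rightarrow>\<^sub>0 int) \<Rightarrow> (((nat \<Rightarrow> real) \<Rightarrow> ('v \<Rightarrow> real)) \<Rightarrow>\<^sub>0 int)" where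
  "affine_chain = frag_extend (\<lambda>xs. frag_of (affine_simplex xs))"

text \<open>Degree 0 is excluded because the two boundaries differ there: the singular one is 0,
  whereas \<open>frag_list_bd\<close> sends a vertex to the empty list.\<close>

lemma vertex_chain_boundary:
  assumes "1 \<le> p"
  shows "vertex_chain (p - 1) (chain_boundary p c) = frag_extend frag_list_bd (vertex_chain p c)"
proof -
  have "vertex_chain (p - 1) (chain_boundary p (frag_of f)) = frag_list_bd (vertex_list p f)" for f :: "(nat \<Rightarrow> real) \<Rightarrow> ('a \<Rightarrow> real)"
  proof -
    have "vertex_chain (p - 1) (chain_boundary p (frag_of f)) =
        (\<Sum>k\<le>p. frag_cmul ((-1) ^ k) (frag_of (vertex_list (p - 1) (singular_face p k f))))"
      using assms by (simp add: vertex_chain_def chain_boundary_of frag_extend_sum frag_extend_cmul o_def)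
    also have "\<dots> = frag_list_bd (vertex_list p f)"
      unfolding frag_list_bd_eq_sum using assms
      by (simp add: vertex_list_singular_face[unfolded One_nat_def] lessThan_Suc_atMost)
    finally show ?thesis .
  qed
  with subset_UNIV[of "Poly_Mapping.keys c"] show ?thesis
    by (induction c rule: frag_induction)
      (simp_all add: vertex_chain_def frag_extend_diff chain_boundary_diff)
qed

lemma affine_chain_boundary:
  assumes "Poly_Mapping.keys c \<subseteq> {xs. length xs = Suc p}" "1 \<le> p"
  shows "chain_boundary p (affine_chain c) = affine_chain (frag_extend frag_list_bd c)"
  using assms(1)
proof (induction c rule: frag_induction)
  case (one xs)
  then have len: "length xs = Suc p"
    by simp
  have "chain_boundary p (frag_of (affine_simplex xs)) =
      (\<Sum>k\<le>p. frag_cmul ((-1) ^ k) (frag_of (affine_simplex (take k xs @ drop (Suc k) xs))))"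
    using assms(2) by (simp add: chain_boundary_of singular_face_affine_simplex[OF len])
  also have "\<dots> = affine_chain (frag_list_bd xs)"
    unfolding frag_list_bd_eq_sum len
    by (simp add: affine_chain_def frag_extend_sum frag_extend_cmul o_def lessThan_Suc_atMost)
  finally show ?case
    by (simp add: affine_chain_def)
qed (simp_all add: affine_chain_def frag_extend_diff chain_boundary_diff)

lemma chain_boundary_singular_subdivision_power:
  assumes "singular_chain p X c"
  shows "singular_chain p X ((singular_subdivision p ^^ N) c) \<and>
    chain_boundary p ((singular_subdivision p ^^ N) c) =
    (singular_subdivision (p - 1) ^^ N) (chain_boundary p c)"
  by (induction N)
    (auto simp: assms singular_chain_singular_subdivision chain_boundary_singular_subdivision)

text \<open>A list is sent to the vertex lists of the \<open>N\<close>-fold subdivision of its affine simplex; this is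
  a chain map carried by the simplex, hence homotopic to the identity by coning.\<close>

definition subdivided :: "nat \<Rightarrow> nat \<Rightarrow> 'v list \<Rightarrow> ('v list \<Rightarrow>\<^sub>0 int)" where
  "subdivided N p xs = vertex_chain p ((singular_subdivision p ^^ N) (frag_of (affine_simplex xs)))"

lemma vertex_chain_subdivision_affine_chain:
  "vertex_chain p ((singular_subdivision p ^^ N) (affine_chain c)) = frag_extend (subdivided N p) c"
  using subset_UNIV[of "Poly_Mapping.keys c"]
  by (induction c rule: frag_induction)
    (simp_all add: vertex_chain_def affine_chain_def subdivided_def frag_extend_diff
      singular_subdivision_power_diff)

text \<open>Subdivision stays within the closed simplex spanned by \<open>xs\<close>, and the
  dominant vertices of its points belong to \<open>xs\<close>. So all lists on vertices of
  \<open>xs\<close> serve as an acyclic carrier for the homotopy.\<close>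

lemma keys_subdivided:
  assumes "length xs = Suc p"
  shows "Poly_Mapping.keys (subdivided N p xs) \<subseteq> {ys. set ys \<subseteq> set xs \<and> length ys = Suc p}"
proof -
  let ?X = "top_of_set (closed_simplex (set xs))"
  have "singular_chain p ?X ((singular_subdivision p ^^ N) (frag_of (affine_simplex xs)))"
    using chain_boundary_singular_subdivision_power singular_simplex_affine_simplex[OF assms]
    by (metis singular_chain_of)
  then have sub: "Poly_Mapping.keys ((singular_subdivision p ^^ N) (frag_of (affine_simplex xs)))
      \<subseteq> {f. singular_simplex p ?X f}"
    by (simp add: singular_chain_def)
  show ?thesis
    unfolding subdivided_def vertex_chain_def
  proof (rule keys_frag_extend_subset[OF sub])
    fix f
    assume "f \<in> {f. singular_simplex p ?X f}"
    then have "f x \<in> closed_simplex (set xs)" if "x \<in> standard_simplex p" for x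
      using that unfolding singular_simplex_def continuous_map_def
      by (auto simp: topspace_standard_simplex)
    then have "dominant_vertex (f x) \<in> set xs" if "x \<in> standard_simplex p" for x
      using that by (intro dominant_vertex_in) auto
    then show "Poly_Mapping.keys (frag_of (vertex_list p f)) \<subseteq> {ys. set ys \<subseteq> set xs \<and> length ys = Suc p}"
      using set_vertex_list_subset[of p f] by (simp add: keys_frag_of)
  qed
qed

text \<open>The start of the homotopy: subdivision fixes 0-simplices, and the point \<open>v\<close>
  has no dominant vertex other than \<open>v\<close>.\<close>

lemma subdivided_0:
  assumes "length xs = 1"
  shows "subdivided N 0 xs = frag_of xs"
proof -
  obtain v where xs: "xs = [v]"
    using assms by (metis One_nat_def length_0_conv length_Suc_conv)
  have s: "singular_simplex 0 (top_of_set (closed_simplex {v})) (affine_simplex xs)"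
    using singular_simplex_affine_simplex[of xs 0] by (simp add: xs)
  then have "singular_chain 0 (top_of_set (closed_simplex {v})) (frag_of (affine_simplex xs))"
    by (simp add: singular_chain_of)
  then have "(singular_subdivision 0 ^^ N) (frag_of (affine_simplex xs)) = frag_of (affine_simplex xs)"
    by (induction N) (simp_all add: singular_subdivision_zero)
  then have "subdivided N 0 xs = frag_of (vertex_list 0 (affine_simplex xs))"
    by (simp add: subdivided_def vertex_chain_def)
  moreover have "dominant_vertex (affine_simplex xs x) \<in> {v}" if "x \<in> standard_simplex 0" for x
    using that affine_simplex_in_closed_simplex[of xs x] by (intro dominant_vertex_in) (auto simp: xs)
  then have "set (vertex_list 0 (affine_simplex xs)) \<subseteq> {v}"
    by (rule set_vertex_list_subset)
  then have "vertex_list 0 (affine_simplex xs) = xs"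
    by (auto simp: vertex_list_def xs)
  ultimately show ?thesis
    by simp
qed

lemma frag_list_bd_subdivided:
  assumes "length xs = Suc (Suc p)"
  shows "frag_extend frag_list_bd (subdivided N (Suc p) xs) = frag_extend (subdivided N p) (frag_list_bd xs)"
proof -
  let ?c = "frag_of (affine_simplex xs)"
  have "singular_chain (Suc p) (top_of_set (closed_simplex (set xs))) ?c"
    using singular_simplex_affine_simplex[OF assms] by (simp add: singular_chain_of)
  then have "chain_boundary (Suc p) ((singular_subdivision (Suc p) ^^ N) ?c) =
      (singular_subdivision p ^^ N) (chain_boundary (Suc p) ?c)"
    using chain_boundary_singular_subdivision_power by (metis diff_Suc_1)
  moreover have "chain_boundary (Suc p) ?c = affine_chain (frag_list_bd xs)"
    using affine_chain_boundary[of "frag_of xs" "Suc p"] assms by (simp add: keys_frag_of affine_chain_def)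
  ultimately show ?thesis
    using vertex_chain_boundary[of "Suc p" "(singular_subdivision (Suc p) ^^ N) ?c"]
    by (simp add: subdivided_def flip: vertex_chain_subdivision_affine_chain)
qed

text \<open>The method of acyclic carriers: the defect left over from the lower degree is coned off
  from \<open>hd xs\<close>, a vertex of \<open>xs\<close> itself, so the homotopy does not leave
  the simplex.\<close>

primrec subdivided_homotopy :: "nat \<Rightarrow> nat \<Rightarrow> 'v list \<Rightarrow> ('v list \<Rightarrow>\<^sub>0 int)" where
  "subdivided_homotopy N 0 xs = 0"
| "subdivided_homotopy N (Suc p) xs = list_cone (hd xs) (subdivided N (Suc p) xs - frag_of xs -
     frag_extend (subdivided_homotopy N p) (frag_list_bd xs))"

lemma keys_subdivided_homotopy:
  "length xs = Suc p \<Longrightarrow> Poly_Mapping.keys (subdivided_homotopy N p xs) \<subseteq>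
     {ys. set ys \<subseteq> set xs \<and> length ys = Suc (Suc p)}"
proof (induction p arbitrary: xs)
  case (Suc p)
  let ?A = "{ys. set ys \<subseteq> set xs \<and> length ys = Suc (Suc p)}"
  have "Poly_Mapping.keys (frag_extend (subdivided_homotopy N p) (frag_list_bd xs)) \<subseteq> ?A"
  proof (rule keys_frag_extend_subset[OF keys_frag_list_bd_subset])
    fix ys
    assume "ys \<in> {ys. set ys \<subseteq> set xs \<and> Suc (length ys) = length xs}"
    then show "Poly_Mapping.keys (subdivided_homotopy N p ys) \<subseteq> ?A"
      using Suc.IH[of ys] Suc.prems by auto
  qed
  then have *: "Poly_Mapping.keys (subdivided N (Suc p) xs - frag_of xs -
      frag_extend (subdivided_homotopy N p) (frag_list_bd xs)) \<subseteq> ?A"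
    using keys_subdivided[OF Suc.prems, of N] Suc.prems
    by (intro keys_diff_subset) (auto simp: keys_frag_of)
  have "hd xs \<in> set xs"
    using Suc.prems by (cases xs) auto
  then show ?case
    unfolding subdivided_homotopy.simps
    by (intro keys_frag_extend_subset[OF *]) (auto simp: keys_frag_of)
qed simp

text \<open>The defect that is coned off is a cycle, by the identity one degree lower and the chain
  map property of \<open>subdivided\<close>; hence it is the boundary of its cone. The case
  \<open>p = 0\<close> stands apart since the homotopy does not extend to the empty list.\<close>

lemma frag_list_bd_subdivided_homotopy:
  "length xs = Suc p \<Longrightarrow> frag_extend frag_list_bd (subdivided_homotopy N p xs) =
     subdivided N p xs - frag_of xs - (if p = 0 then 0 else frag_extend (subdivided_homotopy N (p - 1)) (frag_list_bd xs))"
proof (induction p arbitrary: xs)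
  case 0
  then show ?case
    by (simp add: subdivided_0)
next
  case (Suc p)
  define E where "E = subdivided N (Suc p) xs - frag_of xs -
     frag_extend (subdivided_homotopy N p) (frag_list_bd xs)"
  have len: "length ys = Suc p" if "ys \<in> Poly_Mapping.keys (frag_list_bd xs)" for ys
    using that keys_frag_list_bd_subset[of xs] Suc.prems by auto
  have "frag_extend frag_list_bd (frag_extend (subdivided_homotopy N p) (frag_list_bd xs)) =
      frag_extend (\<lambda>ys. subdivided N p ys - frag_of ys -
        (if p = 0 then 0 else frag_extend (subdivided_homotopy N (p - 1)) (frag_list_bd ys))) (frag_list_bd xs)"
    unfolding frag_extend_frag_extend by (rule frag_extend_eq) (rule Suc.IH[OF len])
  also have "\<dots> = frag_extend (subdivided N p) (frag_list_bd xs) - frag_list_bd xs -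
      (if p = 0 then 0
       else frag_extend (subdivided_homotopy N (p - 1)) (frag_extend frag_list_bd (frag_list_bd xs)))"
    by (simp add: frag_extend_fun_diff frag_extend_frag_extend frag_extend_eq_0)
  finally have "frag_extend frag_list_bd E = 0"
    using frag_list_bd_subdivided[OF Suc.prems, of N]
    by (simp add: E_def frag_extend_diff frag_list_bd_frag_list_bd)
  then show ?case
    by (simp add: E_def[symmetric] frag_list_bd_list_cone)
qed

text \<open>Reading off vertices from a fine subdivision of a bounding singular chain gives
  \<open>y\<close> with boundary the subdivided \<open>z\<close>. The homotopy applied to
  \<open>z\<close> bounds the difference between the subdivided \<open>z\<close> and
  \<open>z\<close>, so subtracting it from \<open>y\<close> gives a chain bounding \<open>z\<close>
  itself.\<close>

lemma contractible_frag_list_bd_exact: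
  assumes K: "abstract_simplicial_complex K" "K \<noteq> {}" and X: "contractible_space (realization_topology K)"
    and z: "Poly_Mapping.keys z \<subseteq> {xs. set xs \<in> insert {} K \<and> length xs = n}"
      "frag_extend frag_list_bd z = 0"
  shows "\<exists>y. Poly_Mapping.keys y \<subseteq> {xs. set xs \<in> insert {} K \<and> length xs = Suc n} \<and>
    frag_extend frag_list_bd y = z"
proof (cases n)
  \<comment> \<open>In the degree of the empty list, exactness is surjectivity of the augmentation;
    any vertex of the nonempty complex gives a preimage.\<close>
  case 0
  obtain s where s: "s \<in> K"
    using K(2) by blast
  then obtain v where "v \<in> s"
    using simplex_nonempty[OF K(1)] by blast
  then have v: "{v} \<in> K"
    using simplex_mono[OF K(1) s, of "{v}"] by blast
  have "Poly_Mapping.keys z \<subseteq> {[]}"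
    using z(1) 0 by auto
  then have "frag_extend frag_list_bd (list_cone v z) = z"
    by (induction z rule: frag_induction) (simp_all add: frag_extend_diff)
  moreover have "Poly_Mapping.keys (list_cone v z) \<subseteq> {xs. set xs \<in> insert {} K \<and> length xs = Suc n}"
    using \<open>Poly_Mapping.keys z \<subseteq> {[]}\<close> by (rule keys_frag_extend_subset) (use v 0 in \<open>simp add: keys_frag_of\<close>)
  ultimately show ?thesis
    by blast
next
  case (Suc p)
  let ?X = "realization_topology K"
  let ?L = "\<lambda>p. {xs. set xs \<in> insert {} K \<and> length xs = Suc p}"
  have z': "Poly_Mapping.keys z \<subseteq> ?L p"
    using z(1) by (simp add: Suc)
  have mono: "t \<in> insert {} K" if "s \<in> insert {} K" "t \<subseteq> s" for s t
    using that simplex_mono[OF K(1), of s t] by blast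
  have L_K: "set xs \<in> K" if "xs \<in> ?L p" for xs p
    using that by auto
  have "singular_chain p ?X (affine_chain z)"
    unfolding affine_chain_def
  proof (rule singular_chain_extend)
    fix xs
    assume "xs \<in> Poly_Mapping.keys z"
    then have xs: "xs \<in> ?L p"
      using z' by blast
    then have "singular_simplex p (top_of_set (closed_simplex (set xs))) (affine_simplex xs)"
      using singular_simplex_affine_simplex by blast
    then have "singular_simplex p ?X (affine_simplex xs)"
      using continuous_map_compose[OF _ continuous_map_closed_simplex[OF L_K[OF xs]]]
      by (auto simp: singular_simplex_def o_def)
    then show "singular_chain p ?X (frag_of (affine_simplex xs))"
      by (simp add: singular_chain_of)
  qed
  moreover have "chain_boundary p (affine_chain z) = 0"
  proof (cases "p = 0")
    case True
    then show ?thesis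
      by (simp add: chain_boundary_def)
  next
    case False
    have "Poly_Mapping.keys z \<subseteq> {xs. length xs = Suc p}"
      using z' by blast
    then show ?thesis
      using affine_chain_boundary[of z p] False z(2) by (simp add: affine_chain_def)
  qed
  \<comment> \<open>Collapsing everything to \<open>a\<close> leaves one point simplex, whose
    coefficient is the augmentation of \<open>z\<close>. In this degree \<open>frag_list_bd\<close>
    computes that augmentation, and it is zero on \<open>z\<close>.\<close>
  moreover have "chain_map p (\<lambda>x. a) (affine_chain z) = 0" if "p = 0" for a :: "'a \<Rightarrow> real"
  proof -
    let ?g = "frag_of (restrict (\<lambda>x. a) (standard_simplex 0))"
    have "chain_map 0 (\<lambda>x. a) (affine_chain c) = frag_extend (\<lambda>_. ?g) (frag_extend frag_list_bd c)"
      if "Poly_Mapping.keys c \<subseteq> {xs. length xs = 1}" for c :: "'a list \<Rightarrow>\<^sub>0 int"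
      using that
    proof (induction c rule: frag_induction)
      case (one xs)
      then obtain v where "xs = [v]"
        by (auto simp: length_Suc_conv)
      then show ?case
        by (simp add: affine_chain_def simplex_map_def o_def restrict_def)
    qed (simp_all add: affine_chain_def frag_extend_diff chain_map_diff)
    moreover have "Poly_Mapping.keys z \<subseteq> {xs. length xs = 1}"
      using z' \<open>p = 0\<close> by auto
    ultimately show ?thesis
      using z(2) \<open>p = 0\<close> by simp
  qed
  ultimately obtain d where d: "singular_chain (Suc p) ?X d" "chain_boundary (Suc p) d = affine_chain z"
    using contractible_cycle_is_boundary[OF X] by blast
  have "topspace ?X \<subseteq> \<Union>(dominated_by K ` K)"
    using closed_simplex_subset_dominated_by[OF K(1)]
    by (fastforce simp: topspace_realization_topology realization_def)
  moreover have "openin ?X U" if "U \<in> dominated_by K ` K" for U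
    using that openin_dominated_by[OF K(1)] by blast
  \<comment> \<open>After enough subdivisions each singular simplex lies in a single dominated set,
    so its corners are sent to vertices of one simplex of \<open>K\<close>.\<close>
  ultimately obtain N where N: "\<And>f. f \<in> Poly_Mapping.keys ((singular_subdivision (Suc p) ^^ N) d) \<Longrightarrow>
      \<exists>V \<in> dominated_by K ` K. f \<in> standard_simplex (Suc p) \<rightarrow> V"
    using sufficient_iterated_singular_subdivision_exists[OF _ _ d(1), of "dominated_by K ` K"]
    by (metis order_refl)
  define y where "y = vertex_chain (Suc p) ((singular_subdivision (Suc p) ^^ N) d)"
  have "Poly_Mapping.keys y \<subseteq> ?L (Suc p)"
    unfolding y_def vertex_chain_def
  proof (rule keys_frag_extend_subset[OF order_refl])
    fix f
    assume "f \<in> Poly_Mapping.keys ((singular_subdivision (Suc p) ^^ N) d)"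
    then obtain s where s: "s \<in> K" "f \<in> standard_simplex (Suc p) \<rightarrow> dominated_by K s"
      using N by blast
    then have "set (vertex_list (Suc p) f) \<subseteq> s"
      using dominant_vertex_in_dominated_by[OF K(1)] by (intro set_vertex_list_subset) blast
    then show "Poly_Mapping.keys (frag_of (vertex_list (Suc p) f)) \<subseteq> ?L (Suc p)"
      using mono[of s "set (vertex_list (Suc p) f)"] s(1) by (auto simp: keys_frag_of)
  qed
  moreover have "Poly_Mapping.keys (frag_extend (subdivided_homotopy N p) z) \<subseteq> ?L (Suc p)"
  proof (rule keys_frag_extend_subset[OF z'])
    fix xs
    assume xs: "xs \<in> ?L p"
    then show "Poly_Mapping.keys (subdivided_homotopy N p xs) \<subseteq> ?L (Suc p)"
      using keys_subdivided_homotopy[of xs p N] mono[of "set xs"] by blast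
  qed
  ultimately have "Poly_Mapping.keys (y - frag_extend (subdivided_homotopy N p) z) \<subseteq> ?L (Suc p)"
    by (rule keys_diff_subset)
  moreover have "frag_extend frag_list_bd y = frag_extend (subdivided N p) z"
    using vertex_chain_boundary[of "Suc p" "(singular_subdivision (Suc p) ^^ N) d"]
      chain_boundary_singular_subdivision_power[OF d(1), of N] d(2)
    by (simp add: y_def vertex_chain_subdivision_affine_chain)
  moreover have "frag_extend frag_list_bd (frag_extend (subdivided_homotopy N p) z) =
      frag_extend (subdivided N p) z - z"
  proof -
    have "frag_extend frag_list_bd (frag_extend (subdivided_homotopy N p) z) =
      frag_extend (\<lambda>xs. subdivided N p xs - frag_of xs -
        (if p = 0 then 0 else frag_extend (subdivided_homotopy N (p - 1)) (frag_list_bd xs))) z"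
      unfolding frag_extend_frag_extend
      by (rule frag_extend_eq) (use z' in \<open>intro frag_list_bd_subdivided_homotopy; blast\<close>)
    also have "\<dots> = frag_extend (subdivided N p) z - z - (if p = 0 then 0
        else frag_extend (subdivided_homotopy N (p - 1)) (frag_extend frag_list_bd z))"
      by (simp add: frag_extend_fun_diff frag_extend_frag_extend frag_extend_eq_0)
    finally show ?thesis
      by (simp add: z(2))
  qed
  ultimately show ?thesis
    unfolding Suc by (intro exI[of _ "y - frag_extend (subdivided_homotopy N p) z"])
      (simp add: frag_extend_diff)
qed

subsection \<open>Exactness with real coefficients\<close>

definition realify :: "('a \<Rightarrow>\<^sub>0 int) \<Rightarrow> ('a \<Rightarrow>\<^sub>0 real)" where
  "realify = Poly_Mapping.map real_of_int"

lemma lookup_realify [simp]: "Poly_Mapping.lookup (realify c) a = real_of_int (Poly_Mapping.lookup c a)"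
  by (simp add: realify_def map.rep_eq when_def)

lemma keys_realify [simp]: "Poly_Mapping.keys (realify c) = Poly_Mapping.keys c"
  by (auto simp: in_keys_iff)

lemma realify_0 [simp]: "realify 0 = 0"
  by (rule poly_mapping_eqI) simp

lemma realify_diff: "realify (c - d) = realify c - realify d"
  by (rule poly_mapping_eqI) (simp add: lookup_minus)

lemma realify_frag_of [simp]: "realify (frag_of a) = Poly_Mapping.single a 1"
  by (rule poly_mapping_eqI) (simp add: lookup_single when_def)

lemma realify_frag_extend: "realify (frag_extend f c) = lin (\<lambda>a. realify (f a)) (realify c)"
  using subset_UNIV[of "Poly_Mapping.keys c"]
  by (induction c rule: frag_induction) (simp_all add: frag_extend_diff realify_diff)

lemma realify_frag_list_bd: "realify (frag_list_bd xs) = list_bd xs"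
  by (induction xs) (simp_all add: realify_diff realify_frag_extend)

text \<open>Built degree by degree: for a list \<open>xs\<close>, the chain
  \<open>frag_of xs - frag_extend \<eta> (frag_list_bd xs)\<close> is a cycle by the identity one
  degree lower, and exactness supplies its preimage. A contraction given on lists can be extended to
  real coefficients, which is the purpose of this strengthening.\<close>

lemma frag_list_contraction:
  assumes down: "\<And>n xs. xs \<in> L (Suc n) \<Longrightarrow> Poly_Mapping.keys (frag_list_bd xs) \<subseteq> L n"
    and L0: "L 0 \<subseteq> {[]}"
    and exact: "\<And>n z. Poly_Mapping.keys z \<subseteq> L n \<Longrightarrow> frag_extend frag_list_bd z = 0 \<Longrightarrow>
      \<exists>y. Poly_Mapping.keys y \<subseteq> L (Suc n) \<and> frag_extend frag_list_bd y = z"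
  shows "\<exists>\<eta> \<eta>'. \<forall>xs\<in>L n. Poly_Mapping.keys (\<eta> xs) \<subseteq> L (Suc n) \<and>
    frag_extend frag_list_bd (\<eta> xs) = frag_of xs - frag_extend \<eta>' (frag_list_bd xs)"
proof (induction n)
  case 0
  have "\<exists>y. Poly_Mapping.keys y \<subseteq> L (Suc 0) \<and> frag_extend frag_list_bd y = frag_of xs"
    if "xs \<in> L 0" for xs
    using that L0 by (intro exact) (auto simp: keys_frag_of)
  then obtain \<eta> where "\<And>xs. xs \<in> L 0 \<Longrightarrow> Poly_Mapping.keys (\<eta> xs) \<subseteq> L (Suc 0) \<and>
      frag_extend frag_list_bd (\<eta> xs) = frag_of xs"
    by metis
  then show ?case
    using L0 by (intro exI[of _ \<eta>] exI[of _ "\<lambda>_. 0"]) (auto simp: frag_extend_eq_0)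
next
  case (Suc n)
  then obtain \<eta> \<eta>' where \<eta>: "\<And>xs. xs \<in> L n \<Longrightarrow> Poly_Mapping.keys (\<eta> xs) \<subseteq> L (Suc n)"
    "\<And>xs. xs \<in> L n \<Longrightarrow> frag_extend frag_list_bd (\<eta> xs) = frag_of xs - frag_extend \<eta>' (frag_list_bd xs)"
    by blast
  have "\<exists>y. Poly_Mapping.keys y \<subseteq> L (Suc (Suc n)) \<and>
      frag_extend frag_list_bd y = frag_of xs - frag_extend \<eta> (frag_list_bd xs)"
    if xs: "xs \<in> L (Suc n)" for xs
  proof (rule exact)
    have "Poly_Mapping.keys (frag_extend \<eta> (frag_list_bd xs)) \<subseteq> L (Suc n)"
      using down[OF xs] \<eta>(1) by (rule keys_frag_extend_subset)
    then show "Poly_Mapping.keys (frag_of xs - frag_extend \<eta> (frag_list_bd xs)) \<subseteq> L (Suc n)"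
      using xs by (intro keys_diff_subset) (auto simp: keys_frag_of)
    have "frag_extend frag_list_bd (frag_extend \<eta> (frag_list_bd xs)) =
        frag_extend (\<lambda>ys. frag_of ys - frag_extend \<eta>' (frag_list_bd ys)) (frag_list_bd xs)"
      unfolding frag_extend_frag_extend by (rule frag_extend_eq) (use down[OF xs] \<eta>(2) in blast)
    also have "\<dots> = frag_list_bd xs - frag_extend \<eta>' (frag_extend frag_list_bd (frag_list_bd xs))"
      by (simp add: frag_extend_fun_diff frag_extend_frag_extend)
    finally show "frag_extend frag_list_bd (frag_of xs - frag_extend \<eta> (frag_list_bd xs)) = 0"
      by (simp add: frag_extend_diff frag_list_bd_frag_list_bd)
  qed
  then show ?case
    by metis
qed

context oriented_complex
begin

text \<open>The integral contraction, extended linearly, sends a real cycle to a chain that it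
  bounds: the term with \<eta>' is applied to the boundary of \<open>z\<close> and
  disappears.\<close>

lemma contractible_list_bd_exact:
  assumes "K \<noteq> {}" "contractible_space (realization_topology K)"
    and z: "z \<in> chain_space (face_lists n)" "lin list_bd z = 0"
  shows "\<exists>y\<in>chain_space (face_lists (Suc n)). lin list_bd y = z"
proof -
  have "\<exists>\<eta> \<eta>'. \<forall>xs\<in>face_lists n. Poly_Mapping.keys (\<eta> xs) \<subseteq> face_lists (Suc n) \<and>
      frag_extend frag_list_bd (\<eta> xs) = frag_of xs - frag_extend \<eta>' (frag_list_bd xs)"
  proof (rule frag_list_contraction)
    show "Poly_Mapping.keys (frag_list_bd xs) \<subseteq> face_lists m" if "xs \<in> face_lists (Suc m)" for m xs
      using list_bd_in_chain_space[OF that]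
      by (simp add: chain_space_def flip: realify_frag_list_bd)
    show "face_lists 0 \<subseteq> {[]}"
      by (auto simp: face_lists_def)
    show "\<exists>y. Poly_Mapping.keys y \<subseteq> face_lists (Suc m) \<and> frag_extend frag_list_bd y = z"
      if "Poly_Mapping.keys z \<subseteq> face_lists m" "frag_extend frag_list_bd z = 0" for m z
      using contractible_frag_list_bd_exact[OF complex assms(1,2), of z m] that
      unfolding face_lists_def by blast
  qed
  then obtain \<eta> \<eta>' where \<eta>: "\<And>xs. xs \<in> face_lists n \<Longrightarrow> Poly_Mapping.keys (\<eta> xs) \<subseteq> face_lists (Suc n)"
    "\<And>xs. xs \<in> face_lists n \<Longrightarrow>
      frag_extend frag_list_bd (\<eta> xs) = frag_of xs - frag_extend \<eta>' (frag_list_bd xs)"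
    by blast
  define y where "y = lin (\<lambda>xs. realify (\<eta> xs)) z"
  have "y \<in> chain_space (face_lists (Suc n))"
    unfolding y_def using z(1) by (rule lin_in_chain_space) (simp add: chain_space_def \<eta>(1))
  moreover have "lin list_bd (realify (\<eta> xs)) =
      Poly_Mapping.single xs 1 - lin (\<lambda>ys. realify (\<eta>' ys)) (list_bd xs)" if "xs \<in> face_lists n" for xs
  proof -
    have "lin list_bd (realify (\<eta> xs)) = realify (frag_extend frag_list_bd (\<eta> xs))"
      by (simp add: realify_frag_extend realify_frag_list_bd)
    then show ?thesis
      by (simp add: \<eta>(2)[OF that] realify_diff realify_frag_extend realify_frag_list_bd)
  qed
  then have "lin list_bd y =
      lin (\<lambda>xs. Poly_Mapping.single xs 1 - lin (\<lambda>ys. realify (\<eta>' ys)) (list_bd xs)) z"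
    unfolding y_def lin_lin by (rule lin_cong_chain_space[OF z(1)])
  then have "lin list_bd y = z - lin (\<lambda>ys. realify (\<eta>' ys)) (lin list_bd z)"
    by (simp add: lin_fun_diff lin_lin)
  ultimately show ?thesis
    using z(2) by auto
qed

lemma contractible_bd_exact:
  assumes "K \<noteq> {}" "contractible_space (realization_topology K)"
    and "z \<in> chain_space (faces n)" "lin bd z = 0"
  shows "\<exists>y\<in>chain_space (faces (Suc n)). lin bd y = z"
  using contractible_list_bd_exact[OF assms(1,2)] assms(3,4) by (rule exact_if_face_lists_exact)

end

subsection \<open>Equivariant comparison of free resolutions\<close>

definition acts_on :: "('g::group_add \<Rightarrow> 'a \<Rightarrow> 'a) \<Rightarrow> 'a set \<Rightarrow> bool" where
  "acts_on \<alpha> A \<longleftrightarrow>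
     (\<forall>a\<in>A. \<alpha> 0 a = a \<and> (\<forall>g h. \<alpha> (g + h) a = \<alpha> g (\<alpha> h a)) \<and> (\<forall>g. \<alpha> g a \<in> A))"

definition acts_freely_on :: "('g::group_add \<Rightarrow> 'a \<Rightarrow> 'a) \<Rightarrow> 'a set \<Rightarrow> bool" where
  "acts_freely_on \<alpha> A \<longleftrightarrow> acts_on \<alpha> A \<and> (\<forall>a\<in>A. \<forall>g. \<alpha> g a = a \<longrightarrow> g = 0)"

lemma acts_freely_onD:
  assumes "acts_freely_on \<alpha> A" "a \<in> A" "\<alpha> g a = \<alpha> h a"
  shows "g = h"
proof -
  have act: "\<And>g h. \<alpha> (g + h) a = \<alpha> g (\<alpha> h a)" "\<alpha> 0 a = a"
    using assms(1,2) by (auto simp: acts_freely_on_def acts_on_def)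
  have "\<alpha> (- h + g) a = a"
    using act(1)[of "- h" g] act(1)[of "- h" h] act(2) assms(3) by simp
  then have "- h + g = 0"
    using assms(1,2) by (auto simp: acts_freely_on_def)
  then show ?thesis
    by (simp add: add_eq_0_iff)
qed

text \<open>Choose a value at one representative per orbit and transport it; freeness makes the
  transporting group element unique. The laws for \<beta> are asked only of admissible values
  because \<open>push\<close> is an action only on chains with suitable support.\<close>

lemma equivariant_choice:
  assumes free: "acts_freely_on \<alpha> A"
    and \<beta>: "\<And>a y. a \<in> A \<Longrightarrow> P a y \<Longrightarrow> \<beta> 0 y = y \<and> (\<forall>g h. \<beta> (g + h) y = \<beta> g (\<beta> h y))"
    and P: "\<And>a y g. a \<in> A \<Longrightarrow> P a y \<Longrightarrow> P (\<alpha> g a) (\<beta> g y)"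
    and ex: "\<And>a. a \<in> A \<Longrightarrow> \<exists>y. P a y"
  shows "\<exists>f. \<forall>a\<in>A. P a (f a) \<and> (\<forall>g. f (\<alpha> g a) = \<beta> g (f a))"
proof -
  have act: "\<alpha> 0 a = a" "\<alpha> (g + h) a = \<alpha> g (\<alpha> h a)" "\<alpha> g a \<in> A" if "a \<in> A" for a g h
    using that free by (auto simp: acts_freely_on_def acts_on_def)
  \<comment> \<open>The choice is applied to the orbit as a set, so all points of an orbit receive
    the same representative.\<close>
  define r where "r a = (SOME b. b \<in> range (\<lambda>g. \<alpha> g a))" for a
  define \<gamma> where "\<gamma> a = (SOME g. a = \<alpha> g (r a))" for a
  define y where "y b = (SOME y. P b y)" for b
  have r: "r a \<in> A" "a = \<alpha> (\<gamma> a) (r a)" if a: "a \<in> A" for a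
  proof -
    have "r a \<in> range (\<lambda>g. \<alpha> g a)"
      unfolding r_def by (rule someI[of _ "\<alpha> 0 a"]) (rule rangeI)
    then obtain h where h: "r a = \<alpha> h a"
      by blast
    show "r a \<in> A"
      using act(3)[OF a] h by simp
    have "a = \<alpha> (- h) (r a)"
      using act(1)[OF a] act(2)[OF a, of "- h" h] h by simp
    then show "a = \<alpha> (\<gamma> a) (r a)"
      unfolding \<gamma>_def by (rule someI)
  qed
  have r_act: "r (\<alpha> g a) = r a" if a: "a \<in> A" for g a
  proof -
    have "range (\<lambda>h. \<alpha> h (\<alpha> g a)) = range (\<lambda>h. \<alpha> h a)"
    proof (intro subset_antisym image_subsetI)
      show "\<alpha> h (\<alpha> g a) \<in> range (\<lambda>h. \<alpha> h a)" for h
        by (rule image_eqI[of _ _ "h + g"]) (simp_all add: act(2)[OF a])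
      have "\<alpha> h a = \<alpha> (h - g) (\<alpha> g a)" for h
        using act(2)[OF a, of "h - g" g] by simp
      then show "\<alpha> h a \<in> range (\<lambda>h. \<alpha> h (\<alpha> g a))" for h
        by blast
    qed
    then show ?thesis
      by (simp add: r_def)
  qed
  have \<gamma>_act: "\<gamma> (\<alpha> g a) = g + \<gamma> a" if a: "a \<in> A" for g a
  proof (rule acts_freely_onD[OF free r(1)[OF a]])
    show "\<alpha> (\<gamma> (\<alpha> g a)) (r a) = \<alpha> (g + \<gamma> a) (r a)"
      using r(2)[OF act(3)[OF a], of g] r(2)[OF a] act(2)[OF r(1)[OF a], of g "\<gamma> a"] r_act[OF a] by simp
  qed
  have y: "P b (y b)" if "b \<in> A" for b
    unfolding y_def by (rule someI_ex) (rule ex[OF that])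
  define f where "f a = \<beta> (\<gamma> a) (y (r a))" for a
  have "P a (f a)" if a: "a \<in> A" for a
    using P[OF r(1)[OF a] y[OF r(1)[OF a]], of "\<gamma> a"] r(2)[OF a] by (simp add: f_def)
  moreover have "f (\<alpha> g a) = \<beta> g (f a)" if a: "a \<in> A" for g a
    using \<beta>[OF r(1)[OF a] y[OF r(1)[OF a]]] by (simp add: f_def \<gamma>_act[OF a] r_act[OF a])
  ultimately show ?thesis
    by blast
qed

lemma lin_fun_zero [simp]: "lin (\<lambda>_. 0) c = 0"
  by (simp add: lin_def)

definition push :: "('g \<Rightarrow> 'a \<Rightarrow> 'a) \<Rightarrow> 'g \<Rightarrow> ('a \<Rightarrow>\<^sub>0 real) \<Rightarrow> ('a \<Rightarrow>\<^sub>0 real)" where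
  "push \<alpha> g = lin (\<lambda>a. Poly_Mapping.single (\<alpha> g a) 1)"

lemma push_single [simp]: "push \<alpha> g (Poly_Mapping.single a r) = Poly_Mapping.single (\<alpha> g a) r"
  by (simp add: push_def scaleR_single)

lemma linear_push: "linear (push \<alpha> g)"
  unfolding push_def by (rule linear_lin)

lemma push_0 [simp]: "push \<alpha> g 0 = 0"
  by (rule linear_0[OF linear_push])

lemma push_lin: "push \<alpha> g (lin f c) = lin (\<lambda>a. push \<alpha> g (f a)) c"
  by (rule linear_lin_comp[OF linear_push])

lemma lin_push: "lin f (push \<alpha> g c) = lin (\<lambda>a. f (\<alpha> g a)) c"
  by (simp add: push_def lin_lin)

lemma push_zero:
  assumes "acts_on \<alpha> A" "c \<in> chain_space A"
  shows "push \<alpha> 0 c = c"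
proof -
  have "push \<alpha> 0 c = lin (\<lambda>a. Poly_Mapping.single a 1) c"
    unfolding push_def using assms(1)
    by (intro lin_cong_chain_space[OF assms(2)]) (simp add: acts_on_def)
  then show ?thesis
    by simp
qed

lemma push_plus:
  assumes "acts_on \<alpha> A" "c \<in> chain_space A"
  shows "push \<alpha> (g + h) c = push \<alpha> g (push \<alpha> h c)"
  unfolding push_def[of \<alpha> "g + h"] push_def[of \<alpha> h] push_lin using assms(1)
  by (intro lin_cong_chain_space[OF assms(2)]) (simp add: acts_on_def)

lemma push_in_chain_space:
  assumes "acts_on \<alpha> A" "c \<in> chain_space A"
  shows "push \<alpha> g c \<in> chain_space A"
  unfolding push_def using assms(1)
  by (intro lin_in_chain_space[OF assms(2)]) (simp add: acts_on_def single_in_chain_space)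

lemma lin_equivariant:
  assumes "c \<in> chain_space A" "\<And>a. a \<in> A \<Longrightarrow> f (\<alpha> g a) = push \<beta> g (f a)"
  shows "lin f (push \<alpha> g c) = push \<beta> g (lin f c)"
  unfolding lin_push push_lin using assms by (rule lin_cong_chain_space)

lemma chain_space_empty: "c \<in> chain_space {} \<Longrightarrow> c = 0"
  by (simp add: chain_space_def)

text \<open>An exact complex that is free over the group ring, with basis \<open>S n\<close> in degree \<open>n\<close>, except in
  degree \<open>0\<close>, which is for the augmentation.\<close>

locale free_resolution =
  fixes \<alpha> :: "'g::group_add \<Rightarrow> 'a \<Rightarrow> 'a" and S :: "nat \<Rightarrow> 'a set" and d :: "'a \<Rightarrow> ('a \<Rightarrow>\<^sub>0 real)"
    and e :: 'a
  assumes S_0: "S 0 = {e}"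
    and acts: "acts_on \<alpha> (S n)"
    and free: "acts_freely_on \<alpha> (S (Suc n))"
    and d_0: "d e = 0"
    and d_in: "a \<in> S (Suc n) \<Longrightarrow> d a \<in> chain_space (S n)"
    and d_d: "a \<in> S n \<Longrightarrow> lin d (d a) = 0"
    and d_equivariant: "a \<in> S n \<Longrightarrow> d (\<alpha> g a) = push \<alpha> g (d a)"
    and exact: "z \<in> chain_space (S n) \<Longrightarrow> lin d z = 0 \<Longrightarrow> \<exists>y\<in>chain_space (S (Suc n)). lin d y = z"
begin

lemma action_e [simp]: "\<alpha> g e = e"
  using acts[of 0] S_0 by (auto simp: acts_on_def)

text \<open>The lifting property of free modules: exactness gives a preimage at each basis element,
  and freeness on \<open>A\<close> allows these to be chosen equivariantly.\<close>

lemma equivariant_lift: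
  assumes free: "acts_freely_on \<beta> A"
    and t: "\<And>a. a \<in> A \<Longrightarrow> t a \<in> chain_space (S n)" "\<And>a. a \<in> A \<Longrightarrow> lin d (t a) = 0"
      "\<And>a g. a \<in> A \<Longrightarrow> t (\<beta> g a) = push \<alpha> g (t a)"
  shows "\<exists>x. \<forall>a\<in>A. (x a \<in> chain_space (S (Suc n)) \<and> lin d (x a) = t a) \<and>
    (\<forall>g. x (\<beta> g a) = push \<alpha> g (x a))"
proof (rule equivariant_choice[OF free])
  fix a y g
  assume a: "a \<in> A" and y: "y \<in> chain_space (S (Suc n)) \<and> lin d y = t a"
  show "push \<alpha> 0 y = y \<and> (\<forall>g h. push \<alpha> (g + h) y = push \<alpha> g (push \<alpha> h y))"
    using push_zero[OF acts] push_plus[OF acts] y by blast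
  have "lin d (push \<alpha> g y) = push \<alpha> g (lin d y)"
    using y d_equivariant by (intro lin_equivariant) auto
  then show "push \<alpha> g y \<in> chain_space (S (Suc n)) \<and> lin d (push \<alpha> g y) = t (\<beta> g a)"
    using push_in_chain_space[OF acts] y t(3)[OF a] by auto
next
  fix a
  assume "a \<in> A"
  then show "\<exists>y. y \<in> chain_space (S (Suc n)) \<and> lin d y = t a"
    using exact[OF t(1,2)] by blast
qed

end

text \<open>The comparison theorem for resolutions. Prescribing degree 0 fixes the map on the
  augmentation module, so maps in the two directions compose to a lift of the identity.\<close>

lemma equivariant_chain_map:
  fixes \<alpha> :: "'g::group_add \<Rightarrow> 'a \<Rightarrow> 'a" and \<beta> :: "'g \<Rightarrow> 'b \<Rightarrow> 'b"
  assumes A: "free_resolution \<alpha> A dA a0" and B: "free_resolution \<beta> B dB b0"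
  shows "\<exists>f. f 0 = (\<lambda>_. Poly_Mapping.single b0 1) \<and>
    (\<forall>n. \<forall>a\<in>A n. f n a \<in> chain_space (B n) \<and> (\<forall>g. f n (\<alpha> g a) = push \<beta> g (f n a))) \<and>
    (\<forall>n. \<forall>a\<in>A (Suc n). lin dB (f (Suc n) a) = lin (f n) (dA a))"
proof -
  interpret A: free_resolution \<alpha> A dA a0 by fact
  interpret B: free_resolution \<beta> B dB b0 by fact
  \<comment> \<open>The clause about cycles is what the next degree needs: it makes the image of
    \<open>dA a\<close> a cycle, which can then be lifted.\<close>
  define P where "P n x \<longleftrightarrow> (n = 0 \<longrightarrow> x = (\<lambda>_. Poly_Mapping.single b0 1)) \<and>
    (\<forall>a\<in>A n. x a \<in> chain_space (B n) \<and> (\<forall>g. x (\<alpha> g a) = push \<beta> g (x a))) \<and>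
    (\<forall>z\<in>chain_space (A n). lin dA z = 0 \<longrightarrow> lin dB (lin x z) = 0)" for n x
  have "\<exists>f. \<forall>n. P n (f n) \<and> (\<forall>a\<in>A (Suc n). lin dB (f (Suc n) a) = lin (f n) (dA a))"
  proof (rule dependent_nat_choice)
    show "\<exists>x. P 0 x"
      by (rule exI[of _ "\<lambda>_. Poly_Mapping.single b0 1"])
        (simp add: P_def B.S_0 single_in_chain_space lin_lin B.d_0)
  next
    fix x n
    assume x: "P n x"
    then have x_in: "\<And>a. a \<in> A n \<Longrightarrow> x a \<in> chain_space (B n)"
      and x_eq: "\<And>a g. a \<in> A n \<Longrightarrow> x (\<alpha> g a) = push \<beta> g (x a)"
      and x_cyc: "\<And>z. z \<in> chain_space (A n) \<Longrightarrow> lin dA z = 0 \<Longrightarrow> lin dB (lin x z) = 0"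
      by (auto simp: P_def)
    have "\<exists>y. \<forall>a\<in>A (Suc n). (y a \<in> chain_space (B (Suc n)) \<and> lin dB (y a) = lin x (dA a)) \<and>
        (\<forall>g. y (\<alpha> g a) = push \<beta> g (y a))"
    proof (rule B.equivariant_lift[OF A.free])
      fix a g
      assume a: "a \<in> A (Suc n)"
      show "lin x (dA a) \<in> chain_space (B n)"
        using A.d_in[OF a] x_in by (rule lin_in_chain_space)
      show "lin dB (lin x (dA a)) = 0"
        using A.d_in[OF a] A.d_d[OF a] by (rule x_cyc)
      show "lin x (dA (\<alpha> g a)) = push \<beta> g (lin x (dA a))"
        unfolding A.d_equivariant[OF a] using A.d_in[OF a] x_eq by (rule lin_equivariant)
    qed
    then obtain y where y: "\<And>a. a \<in> A (Suc n) \<Longrightarrow> y a \<in> chain_space (B (Suc n))"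
      "\<And>a. a \<in> A (Suc n) \<Longrightarrow> lin dB (y a) = lin x (dA a)"
      "\<And>a g. a \<in> A (Suc n) \<Longrightarrow> y (\<alpha> g a) = push \<beta> g (y a)"
      by blast
    have "lin dB (lin y z) = 0" if z: "z \<in> chain_space (A (Suc n))" "lin dA z = 0" for z
    proof -
      have "lin dB (lin y z) = lin (\<lambda>a. lin x (dA a)) z"
        unfolding lin_lin using z(1) y(2) by (rule lin_cong_chain_space)
      then show ?thesis
        using z(2) by (simp flip: lin_lin)
    qed
    then show "\<exists>y. P (Suc n) y \<and> (\<forall>a\<in>A (Suc n). lin dB (y a) = lin x (dA a))"
      using y by (intro exI[of _ y]) (simp add: P_def)
  qed
  then obtain f where f: "\<And>n. P n (f n)"
    "\<And>n. \<forall>a\<in>A (Suc n). lin dB (f (Suc n) a) = lin (f n) (dA a)"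
    by blast
  show ?thesis
  proof (intro exI[of _ f] conjI allI)
    show "f 0 = (\<lambda>_. Poly_Mapping.single b0 1)"
      using f(1)[of 0] by (simp add: P_def)
    show "\<forall>a\<in>A n. f n a \<in> chain_space (B n) \<and> (\<forall>g. f n (\<alpha> g a) = push \<beta> g (f n a))" for n
      using f(1)[of n] unfolding P_def by (elim conjE)
    show "\<forall>a\<in>A (Suc n). lin dB (f (Suc n) a) = lin (f n) (dA a)" for n
      by (rule f(2))
  qed
qed

text \<open>Uniqueness of lifts up to homotopy, for an equivariant chain map \<open>F\<close> over
  the identity of the augmentation. As before, the recursion carries the behaviour on cycles, since
  this shows the next element to be lifted to be a cycle.\<close>

lemma equivariant_homotopy:
  assumes A: "free_resolution \<alpha> A d a0"
    and F_0: "F 0 a0 = Poly_Mapping.single a0 1"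
    and F_in: "\<And>n a. a \<in> A n \<Longrightarrow> F n a \<in> chain_space (A n)"
    and F_eq: "\<And>n a g. a \<in> A n \<Longrightarrow> F n (\<alpha> g a) = push \<alpha> g (F n a)"
    and F_d: "\<And>n a. a \<in> A (Suc n) \<Longrightarrow> lin d (F (Suc n) a) = lin (F n) (d a)"
  shows "\<exists>h. (\<forall>n. \<forall>a\<in>A n. h n a \<in> chain_space (A (Suc n)) \<and> (\<forall>g. h n (\<alpha> g a) = push \<alpha> g (h n a))) \<and>
    (\<forall>n. \<forall>a\<in>A (Suc n). lin d (h (Suc n) a) = Poly_Mapping.single a 1 - F (Suc n) a - lin (h n) (d a))"
proof -
  interpret A: free_resolution \<alpha> A d a0 by fact
  define P where "P n x \<longleftrightarrow>
    (\<forall>a\<in>A n. x a \<in> chain_space (A (Suc n)) \<and> (\<forall>g. x (\<alpha> g a) = push \<alpha> g (x a))) \<and>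
    (\<forall>z\<in>chain_space (A n). lin d z = 0 \<longrightarrow> lin d (lin x z) = z - lin (F n) z)" for n x
  have "\<exists>h. \<forall>n. P n (h n) \<and> (\<forall>a\<in>A (Suc n).
    lin d (h (Suc n) a) = Poly_Mapping.single a 1 - F (Suc n) a - lin (h n) (d a))"
  proof (rule dependent_nat_choice)
    \<comment> \<open>\<open>F\<close> is the identity in degree 0, so the zero map can start the
      homotopy.\<close>
    have "lin (F 0) z = z" if "z \<in> chain_space (A 0)" for z
    proof -
      have "lin (F 0) z = lin (\<lambda>a. Poly_Mapping.single a 1) z"
        using that by (rule lin_cong_chain_space) (simp add: A.S_0 F_0)
      then show ?thesis
        by simp
    qed
    then show "\<exists>x. P 0 x"
      by (intro exI[of _ "\<lambda>_. 0"]) (simp add: P_def lin_def)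
  next
    fix x n
    assume x: "P n x"
    then have x_in: "\<And>a. a \<in> A n \<Longrightarrow> x a \<in> chain_space (A (Suc n))"
      and x_eq: "\<And>a g. a \<in> A n \<Longrightarrow> x (\<alpha> g a) = push \<alpha> g (x a)"
      and x_cyc: "\<And>z. z \<in> chain_space (A n) \<Longrightarrow> lin d z = 0 \<Longrightarrow> lin d (lin x z) = z - lin (F n) z"
      by (auto simp: P_def)
    define t where "t a = Poly_Mapping.single a 1 - F (Suc n) a - lin x (d a)" for a
    have "\<exists>y. \<forall>a\<in>A (Suc n). (y a \<in> chain_space (A (Suc (Suc n))) \<and> lin d (y a) = t a) \<and>
        (\<forall>g. y (\<alpha> g a) = push \<alpha> g (y a))"
    proof (rule A.equivariant_lift[OF A.free])
      fix a g
      assume a: "a \<in> A (Suc n)"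
      have "lin x (d a) \<in> chain_space (A (Suc n))"
        using A.d_in[OF a] x_in by (rule lin_in_chain_space)
      then show "t a \<in> chain_space (A (Suc n))"
        unfolding t_def using a
        by (intro subspace_diff[OF subspace_chain_space] single_in_chain_space F_in)
      show "lin d (t a) = 0"
        using x_cyc[OF A.d_in[OF a] A.d_d[OF a]] by (simp add: t_def F_d[OF a])
      have "lin x (d (\<alpha> g a)) = push \<alpha> g (lin x (d a))"
        unfolding A.d_equivariant[OF a] using A.d_in[OF a] x_eq by (rule lin_equivariant)
      then show "t (\<alpha> g a) = push \<alpha> g (t a)"
        by (simp add: t_def F_eq[OF a] linear_diff[OF linear_push])
    qed
    then obtain y where y: "\<And>a. a \<in> A (Suc n) \<Longrightarrow> y a \<in> chain_space (A (Suc (Suc n)))"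
      "\<And>a. a \<in> A (Suc n) \<Longrightarrow> lin d (y a) = t a"
      "\<And>a g. a \<in> A (Suc n) \<Longrightarrow> y (\<alpha> g a) = push \<alpha> g (y a)"
      by blast
    have "lin d (lin y z) = z - lin (F (Suc n)) z" if z: "z \<in> chain_space (A (Suc n))" "lin d z = 0" for z
    proof -
      have "lin d (lin y z) = lin t z"
        unfolding lin_lin using z(1) y(2) by (rule lin_cong_chain_space)
      also have "\<dots> = z - lin (F (Suc n)) z - lin x (lin d z)"
        unfolding t_def lin_fun_diff lin_lin by simp
      finally show ?thesis
        using z(2) by simp
    qed
    then show "\<exists>y. P (Suc n) y \<and> (\<forall>a\<in>A (Suc n).
        lin d (y a) = Poly_Mapping.single a 1 - F (Suc n) a - lin x (d a))"
      using y by (intro exI[of _ y]) (simp add: P_def t_def)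
  qed
  then obtain h where h: "\<And>n. P n (h n)" "\<And>n. \<forall>a\<in>A (Suc n).
      lin d (h (Suc n) a) = Poly_Mapping.single a 1 - F (Suc n) a - lin (h n) (d a)"
    by blast
  show ?thesis
  proof (intro exI[of _ h] conjI allI)
    show "\<forall>a\<in>A n. h n a \<in> chain_space (A (Suc n)) \<and> (\<forall>g. h n (\<alpha> g a) = push \<alpha> g (h n a))" for n
      using h(1)[of n] unfolding P_def by (elim conjE)
    show "\<forall>a\<in>A (Suc n).
        lin d (h (Suc n) a) = Poly_Mapping.single a 1 - F (Suc n) a - lin (h n) (d a)" for n
      by (rule h(2))
  qed
qed

text \<open>The composite of the comparison maps from \<open>A\<close> to \<open>B\<close> and back
  is homotopic to the identity. It factors through \<open>B\<close> and so is zero from degree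
  \<open>N\<close> on, where the homotopy therefore becomes a contraction.\<close>

lemma equivariant_contraction_above:
  fixes \<alpha> :: "'g::group_add \<Rightarrow> 'a \<Rightarrow> 'a" and \<beta> :: "'g \<Rightarrow> 'b \<Rightarrow> 'b"
  assumes A: "free_resolution \<alpha> A dA a0" and B: "free_resolution \<beta> B dB b0"
    and B_empty: "\<And>n. N \<le> n \<Longrightarrow> B n = {}"
  shows "\<exists>h. (\<forall>n. \<forall>a\<in>A n. h n a \<in> chain_space (A (Suc n)) \<and> (\<forall>g. h n (\<alpha> g a) = push \<alpha> g (h n a))) \<and>
    (\<forall>n. N \<le> Suc n \<longrightarrow> (\<forall>a\<in>A (Suc n).
      lin dA (h (Suc n) a) = Poly_Mapping.single a 1 - lin (h n) (dA a)))"
proof -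
  interpret A: free_resolution \<alpha> A dA a0 by fact
  interpret B: free_resolution \<beta> B dB b0 by fact
  obtain f where f_0: "f 0 = (\<lambda>_. Poly_Mapping.single b0 1)"
    and f: "\<And>n a. a \<in> A n \<Longrightarrow> f n a \<in> chain_space (B n)"
      "\<And>n a g. a \<in> A n \<Longrightarrow> f n (\<alpha> g a) = push \<beta> g (f n a)"
      "\<And>n a. a \<in> A (Suc n) \<Longrightarrow> lin dB (f (Suc n) a) = lin (f n) (dA a)"
    using equivariant_chain_map[OF A B] by blast
  obtain k where k_0: "k 0 = (\<lambda>_. Poly_Mapping.single a0 1)"
    and k: "\<And>n b. b \<in> B n \<Longrightarrow> k n b \<in> chain_space (A n)"
      "\<And>n b g. b \<in> B n \<Longrightarrow> k n (\<beta> g b) = push \<alpha> g (k n b)"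
      "\<And>n b. b \<in> B (Suc n) \<Longrightarrow> lin dA (k (Suc n) b) = lin (k n) (dB b)"
    using equivariant_chain_map[OF B A] by blast
  define F where "F n a = lin (k n) (f n a)" for n a
  have "\<exists>h. (\<forall>n. \<forall>a\<in>A n. h n a \<in> chain_space (A (Suc n)) \<and> (\<forall>g. h n (\<alpha> g a) = push \<alpha> g (h n a))) \<and>
    (\<forall>n. \<forall>a\<in>A (Suc n). lin dA (h (Suc n) a) = Poly_Mapping.single a 1 - F (Suc n) a - lin (h n) (dA a))"
  proof (rule equivariant_homotopy[OF A])
    show "F 0 a0 = Poly_Mapping.single a0 1"
      by (simp add: F_def f_0 k_0)
  next
    fix n a
    assume "a \<in> A n"
    then show "F n a \<in> chain_space (A n)"
      unfolding F_def using f(1) k(1) lin_in_chain_space by blast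
  next
    fix n a g
    assume a: "a \<in> A n"
    show "F n (\<alpha> g a) = push \<alpha> g (F n a)"
      unfolding F_def f(2)[OF a] using f(1)[OF a] k(2) by (rule lin_equivariant)
  next
    fix n a
    assume a: "a \<in> A (Suc n)"
    have "lin dA (F (Suc n) a) = lin (\<lambda>b. lin (k n) (dB b)) (f (Suc n) a)"
      unfolding F_def lin_lin using f(1)[OF a] k(3) by (rule lin_cong_chain_space)
    also have "\<dots> = lin (k n) (lin dB (f (Suc n) a))"
      by (simp add: lin_lin)
    also have "\<dots> = lin (F n) (dA a)"
      unfolding f(3)[OF a] lin_lin F_def ..
    finally show "lin dA (F (Suc n) a) = lin (F n) (dA a)" .
  qed
  moreover have "F n a = 0" if "N \<le> n" "a \<in> A n" for n a
    using f(1)[OF that(2)] B_empty[OF that(1)] chain_space_empty by (fastforce simp: F_def)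
  ultimately show ?thesis
    by (metis (no_types, lifting) diff_zero)
qed

subsection \<open>Simplicial complexes as free resolutions\<close>

lemma permute_list_transpose:
  "permute_list (Transposition.transpose (length us) (Suc (length us))) (us @ a # b # ws) = us @ b # a # ws"
proof (rule nth_equalityI)
  let ?p = "Transposition.transpose (length us) (Suc (length us))"
  fix i
  assume "i < length (permute_list ?p (us @ a # b # ws))"
  then have i: "i < length (us @ a # b # ws)"
    by simp
  have "?p permutes {..<length (us @ a # b # ws)}"
    by (rule permutes_swap_id) auto
  then have "permute_list ?p (us @ a # b # ws) ! i = (us @ a # b # ws) ! ?p i"
    using i by (rule permute_list_nth)
  also have "\<dots> = (us @ b # a # ws) ! i"
  proof -
    consider "i < length us" | "i = length us" | "i = Suc (length us)" | j where "i = Suc (Suc (length us + j))"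
      by (metis add_Suc_right le_iff_add linorder_neqE_nat not_less_eq nat_less_le less_Suc_eq_le Suc_leI add_Suc)
    then show ?thesis
      by cases (auto simp: nth_append transpose_def)
  qed
  finally show "permute_list ?p (us @ a # b # ws) ! i = (us @ b # a # ws) ! i" .
qed simp

text \<open>The value at the empty list makes the boundary of a vertex its augmentation.\<close>

definition sign_function :: "'v set set \<Rightarrow> ('v list \<Rightarrow> int) \<Rightarrow> 'v list \<Rightarrow> real" where
  "sign_function K ori xs =
     (if xs = [] then 1 else if distinct xs \<and> set xs \<in> K then real_of_int (ori xs) else 0)"

lemma simplicial_actionD:
  assumes "simplicial_action act K"
  shows "v \<in> \<Union>K \<Longrightarrow> act 0 v = v" "v \<in> \<Union>K \<Longrightarrow> act (g + h) v = act g (act h v)"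
    "s \<in> K \<Longrightarrow> act g ` s \<in> K"
  using assms unfolding simplicial_action_def by blast+

lemma simplicial_action_inverse:
  assumes "simplicial_action act K" "v \<in> \<Union>K"
  shows "act (- g) (act g v) = v" "act g (act (- g) v) = v"
  using simplicial_actionD(1,2)[OF assms(1), of v] assms(2) by (metis left_minus right_minus)+

lemma inj_on_simplicial_action:
  assumes "simplicial_action act K"
  shows "inj_on (act g) (\<Union>K)"
  by (rule inj_on_inverseI[of _ "act (- g)"]) (use simplicial_action_inverse[OF assms] in blast)

lemma oriented_complex_sign_function:
  fixes K :: "'v set set"
  assumes K: "abstract_simplicial_complex K" and ori: "invariant_orientation act K ori"
  shows "oriented_complex K (sign_function K ori)"
proof
  show "abstract_simplicial_complex K"
    by fact
  show "sign_function K ori xs = 0" if "set xs \<notin> insert {} K" for xs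
    using that by (auto simp: sign_function_def)
  show "sign_function K ori xs * sign_function K ori xs = 1"
    if "distinct xs" "set xs \<in> insert {} K" for xs
  proof (cases "xs = []")
    case False
    then have "set xs \<in> K"
      using that by simp
    then have "ori xs \<in> {1, -1}"
      using that ori unfolding invariant_orientation_def by blast
    then show ?thesis
      using that by (auto simp: sign_function_def)
  qed (simp add: sign_function_def)
  show "alternating (sign_function K ori)"
    unfolding alternating_def
  proof (intro allI)
    fix us ws :: "'v list" and a b
    let ?xs = "us @ a # b # ws" and ?ys = "us @ b # a # ws"
    have eq: "set ?ys = set ?xs" "distinct ?ys \<longleftrightarrow> distinct ?xs"
      by auto
    show "sign_function K ori ?xs = - sign_function K ori ?ys"
    proof (cases "distinct ?xs \<and> set ?xs \<in> K")
      case True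
      let ?p = "Transposition.transpose (length us) (Suc (length us))"
      have "?p permutes {..<length ?xs}"
        by (rule permutes_swap_id) auto
      then have "ori (permute_list ?p ?xs) = sign ?p * ori ?xs"
        using ori True unfolding invariant_orientation_def by blast
      then have "ori ?ys = - ori ?xs"
        by (simp add: permute_list_transpose sign_swap_id)
      then show ?thesis
        using True eq by (simp add: sign_function_def)
    next
      case False
      then show ?thesis
        using eq unfolding sign_function_def by auto
    qed
  qed
qed

section \<open>Invariant orientations from free actions\<close>

lemma permute_list_inj:
  assumes "distinct xs" "p permutes {..<length xs}" "q permutes {..<length xs}"
    and "permute_list p xs = permute_list q xs"
  shows "p = q"
proof
  fix i
  show "p i = q i"
  proof (cases "i < length xs")
    case True
    then have "xs ! p i = xs ! q i"
      using permute_list_nth[OF assms(2) True] permute_list_nth[OF assms(3) True] assms(4) by simp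
    moreover have "p i < length xs" "q i < length xs"
      using permutes_in_image[OF assms(2), of i] permutes_in_image[OF assms(3), of i] True by auto
    ultimately show ?thesis
      using assms(1) nth_eq_iff_index_eq by blast
  next
    case False
    then show ?thesis
      using permutes_not_in[OF assms(2)] permutes_not_in[OF assms(3)] by simp
  qed
qed

lemma ex_permute_list:
  assumes "distinct xs" "distinct ys" "set xs = set ys"
  shows "\<exists>p. p permutes {..<length xs} \<and> permute_list p xs = ys"
proof -
  have "mset ys = mset xs"
    using assms set_eq_iff_mset_eq_distinct by metis
  then obtain p where "p permutes {..<length xs}" "permute_list p xs = ys"
    by (rule mset_eq_permutation)
  then show ?thesis
    by blast
qed

lemma free_action_simplex:
  assumes K: "abstract_simplicial_complex K" and act: "simplicial_action act K"
    and free: "free_action act K" and s: "s \<in> K" "act g ` s = s"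
  shows "g = 0"
proof -
  have fin: "finite s" "s \<noteq> {}"
    using K s(1) by (auto simp: abstract_simplicial_complex_def)
  define t where "t v = (if v \<in> s then 1 / real (card s) else 0)" for v
  have "t \<in> realization K"
    using s(1) fin by (auto simp: realization_def closed_simplex_def t_def intro!: bexI[of _ s])
  moreover have "realization_act act K g t = t"
  proof
    fix v
    show "realization_act act K g t v = t v"
    proof (cases "v \<in> \<Union>K")
      case True
      have "act (- g) v \<in> s \<longleftrightarrow> v \<in> s"
        using simplicial_action_inverse[OF act] True s by (metis (no_types, lifting) UnionI image_iff)
      then show ?thesis
        using True by (simp add: realization_act_def t_def)
    next
      case False
      then show ?thesis
        using s(1) by (auto simp: realization_act_def t_def)
    qed
  qed
  ultimately show ?thesis
    using free by (auto simp: free_action_def)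
qed

lemma acts_on_simplices:
  assumes "simplicial_action act K"
  shows "acts_on (\<lambda>g s. act g ` s) K"
  unfolding acts_on_def
proof (intro ballI conjI allI)
  fix s g h
  assume s: "s \<in> K"
  show "act g ` s \<in> K"
    using simplicial_actionD(3)[OF assms s] .
  have "act 0 ` s = (\<lambda>v. v) ` s"
    using simplicial_actionD(1)[OF assms] s by (intro image_cong) auto
  then show "act 0 ` s = s"
    by simp
  show "act (g + h) ` s = act g ` act h ` s"
    unfolding image_image using simplicial_actionD(2)[OF assms] s by (intro image_cong) auto
qed

lemma acts_freely_on_simplices:
  assumes "abstract_simplicial_complex K" "simplicial_action act K" "free_action act K"
  shows "acts_freely_on (\<lambda>g s. act g ` s) K"
  unfolding acts_freely_on_def using acts_on_simplices[OF assms(2)] free_action_simplex[OF assms] by blast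

text \<open>A stabilizer could reverse an orientation, but freeness leaves only trivial stabilizers.
  So each simplex receives a reference ordering equivariantly, and other orderings are measured
  against it.\<close>

lemma ex_invariant_orientation:
  fixes K :: "'v set set"
  assumes K: "abstract_simplicial_complex K" and act: "simplicial_action act K"
    and free: "free_action act K"
  shows "\<exists>ori. invariant_orientation act K ori"
proof -
  have "\<exists>L. \<forall>s\<in>K. (distinct (L s) \<and> set (L s) = s) \<and> (\<forall>g. L (act g ` s) = map (act g) (L s))"
  proof (rule equivariant_choice[OF acts_freely_on_simplices[OF assms]])
    fix s xs g
    assume s: "s \<in> K" and xs: "distinct xs \<and> set xs = s"
    have sub: "set xs \<subseteq> \<Union>K"
      using s xs by blast
    then have "act 0 v = v" "act (g + h) v = act g (act h v)" if "v \<in> set xs" for g h v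
      using that simplicial_actionD(1,2)[OF act, of v] by blast+
    then show "map (act 0) xs = xs \<and> (\<forall>g h. map (act (g + h)) xs = map (act g) (map (act h) xs))"
      by (simp add: map_idI)
    show "distinct (map (act g) xs) \<and> set (map (act g) xs) = act g ` s"
      using xs inj_on_subset[OF inj_on_simplicial_action[OF act] sub] by (simp add: distinct_map)
  next
    fix s
    assume "s \<in> K"
    then show "\<exists>xs. distinct xs \<and> set xs = s"
      using finite_distinct_list finite_simplex[OF K] by blast
  qed
  then obtain L where "\<forall>s\<in>K. (distinct (L s) \<and> set (L s) = s) \<and> (\<forall>g. L (act g ` s) = map (act g) (L s))"
    by (rule exE)
  then have L: "\<And>s. s \<in> K \<Longrightarrow> distinct (L s)" "\<And>s. s \<in> K \<Longrightarrow> set (L s) = s"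
    "\<And>s g. s \<in> K \<Longrightarrow> L (act g ` s) = map (act g) (L s)"
    by simp_all
  \<comment> \<open>The description is definite because the reference ordering has no repetitions.
    Invariance holds since the permutation acts on positions, whereas the group acts on
    entries.\<close>
  define ori :: "'v list \<Rightarrow> int" where
    "ori xs = sign (THE p. p permutes {..<length (L (set xs))} \<and> permute_list p (L (set xs)) = xs)" for xs
  have ori_eq: "ori xs = sign p"
    if "set xs \<in> K" "p permutes {..<length (L (set xs))}" "permute_list p (L (set xs)) = xs" for xs p
  proof -
    have "(THE p. p permutes {..<length (L (set xs))} \<and> permute_list p (L (set xs)) = xs) = p"
      using that permute_list_inj[OF L(1)[OF that(1)]] by (intro the_equality) auto
    then show ?thesis
      by (simp add: ori_def)
  qed
  have "invariant_orientation act K ori"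
    unfolding invariant_orientation_def
  proof (intro conjI allI ballI impI)
    fix v
    assume "v \<in> \<Union>K"
    then have v: "{v} \<in> K"
      using simplex_mono[OF K, of _ "{v}"] by blast
    have "length (L {v}) = 1"
      using distinct_card[OF L(1)[OF v]] L(2)[OF v] by simp
    then have "L {v} = [v]"
      using L(2)[OF v] by (auto simp: length_Suc_conv)
    then show "ori [v] = 1"
      using ori_eq[of "[v]" id] v by (simp add: permutes_id sign_id)
  next
    fix xs
    assume xs: "distinct xs \<and> set xs \<in> K"
    let ?L = "L (set xs)"
    have len: "length ?L = length xs"
      using xs L(1,2) distinct_card by metis
    obtain p where p: "p permutes {..<length ?L}" "permute_list p ?L = xs"
      using ex_permute_list[of ?L xs] xs L(1,2) by blast
    have ori_xs: "ori xs = sign p"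
      using ori_eq xs p by blast
    show "ori xs \<in> {1, -1}"
      unfolding ori_xs by (auto simp: sign_def)
    show "ori (permute_list q xs) = sign q * ori xs" if q: "q permutes {..<length xs}" for q
    proof -
      have set_eq: "set (permute_list q xs) = set xs"
        using q by simp
      have "permute_list (p \<circ> q) ?L = permute_list q xs"
        using q permute_list_compose[of q ?L p] p(2) len by simp
      moreover have "(p \<circ> q) permutes {..<length ?L}"
        using permutes_compose[of q _ p] q p(1) len by simp
      ultimately have "ori (permute_list q xs) = sign (p \<circ> q)"
        using ori_eq[of "permute_list q xs" "p \<circ> q"] xs set_eq by simp
      also have "\<dots> = sign p * sign q"
        using p(1) q permutation_permutes by (intro sign_compose) blast+
      finally show ?thesis
        by (simp add: ori_xs)
    qed
    show "ori (map (act g) xs) = ori xs" for g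
    proof -
      have L_g: "L (set (map (act g) xs)) = map (act g) ?L"
        using L(3) xs by simp
      have "permute_list p (map (act g) ?L) = map (act g) xs"
        using permute_list_map[OF p(1)] p(2) by simp
      then have "ori (map (act g) xs) = sign p"
        using ori_eq[of "map (act g) xs" p] L_g p(1) simplicial_actionD(3)[OF act] xs by simp
      then show ?thesis
        by (simp add: ori_xs)
    qed
  qed
  then show ?thesis
    by blast
qed

lemma acts_on_subset:
  assumes "acts_on \<alpha> A" "B \<subseteq> A" "\<And>b g. b \<in> B \<Longrightarrow> \<alpha> g b \<in> B"
  shows "acts_on \<alpha> B"
  using assms unfolding acts_on_def by blast

lemma free_resolution_faces:
  assumes K: "free_contractible_complex act K" and ori: "invariant_orientation act K ori"
  shows "free_resolution (\<lambda>g s. act g ` s) (oriented_complex.faces K)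
    (oriented_complex.bd (sign_function K ori)) {}"
proof -
  have complex: "abstract_simplicial_complex K" and "K \<noteq> {}"
    and contr: "contractible_space (realization_topology K)"
    and act: "simplicial_action act K" and free: "free_action act K"
    using K by (auto simp: free_contractible_complex_def)
  interpret oriented_complex K "sign_function K ori"
    by (rule oriented_complex_sign_function[OF complex ori])
  have inj: "inj_on (act g) s" if "s \<in> insert {} K" for g s
    using inj_on_subset[OF inj_on_simplicial_action[OF act]] that by auto
  have acts: "acts_on (\<lambda>g s. act g ` s) (insert {} K)"
    using acts_on_simplices[OF act] by (auto simp: acts_on_def)
  have closed: "act g ` s \<in> faces n" if "s \<in> faces n" for s g n
    using that acts card_image[OF inj[of s g]] unfolding faces_def acts_on_def by auto
  show ?thesis
  proof
    show "faces 0 = {{}}"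
      using finite_face by (auto simp: faces_def)
    show acts_n: "acts_on (\<lambda>g s. act g ` s) (faces n)" for n
    proof (rule acts_on_subset[OF acts])
      show "faces n \<subseteq> insert {} K"
        by (auto simp: faces_def)
    qed (rule closed)
    show "acts_freely_on (\<lambda>g s. act g ` s) (faces (Suc n))" for n
      unfolding acts_freely_on_def
    proof (intro conjI ballI allI impI)
      fix s g
      assume "s \<in> faces (Suc n)" "act g ` s = s"
      then show "g = 0"
        by (intro free_action_simplex[OF complex act free, of s]) (auto simp: faces_def)
    qed (rule acts_n)
    show "bd {} = 0"
      by simp
    show "bd s \<in> chain_space (faces n)" if "s \<in> faces (Suc n)" for s n
      by (rule bd_in_chain_space[OF that])
    show "lin bd (bd s) = 0" if "s \<in> faces n" for s n
      by (rule bd_bd[OF that])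
    show "\<exists>y\<in>chain_space (faces (Suc n)). lin bd y = z"
      if "z \<in> chain_space (faces n)" "lin bd z = 0" for z n
      using contractible_bd_exact[OF \<open>K \<noteq> {}\<close> contr] that .
    show "bd (act g ` s) = push (\<lambda>g s. act g ` s) g (bd s)" if "s \<in> faces n" for s n g
    proof -
      have s: "s \<in> insert {} K"
        using that by (simp add: faces_def)
      have "sign_function K ori (map (act g) xs) = sign_function K ori xs" if xs: "set xs \<subseteq> s" for xs
      proof (cases "distinct xs \<and> xs \<noteq> []")
        case True
        then have xs_K: "set xs \<in> K"
          using face_mono[OF s xs] by simp
        then have "distinct (map (act g) xs)" "set (map (act g) xs) \<in> K"
          using True inj[of "set xs" g] simplicial_actionD(3)[OF act] by (simp_all add: distinct_map)
        moreover have "ori (map (act g) xs) = ori xs"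
          using ori True xs_K unfolding invariant_orientation_def by blast
        ultimately show ?thesis
          using True xs_K by (simp add: sign_function_def)
      next
        case False
        then show ?thesis
          by (auto simp: sign_function_def distinct_map)
      qed
      then show ?thesis
        unfolding push_def using s inj[OF s] by (intro bd_image)
    qed
  qed
qed

text \<open>With two vertices at hand, a negative ordering becomes positive by swapping its first
  two entries, so the choice in \<open>boundary\<close> succeeds. Moreover all faces are nonempty,
  where \<open>sign_function\<close> agrees with \<open>ori\<close>.\<close>

lemma boundary_eq_bd:
  assumes K: "abstract_simplicial_complex K" and ori: "invariant_orientation act K ori"
    and s: "s \<in> K" "2 \<le> card s"
  shows "boundary ori s = oriented_complex.bd (sign_function K ori) s"
proof -
  interpret oriented_complex K "sign_function K ori"
    by (rule oriented_complex_sign_function[OF K ori])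
  have fin: "finite s"
    using finite_face s(1) by blast
  then obtain xs where xs: "distinct xs" "set xs = s"
    using finite_distinct_list by blast
  then obtain a b ws where xs_eq: "xs = a # b # ws"
    using s(2) distinct_card[OF xs(1)] by (metis One_nat_def Suc_1 Suc_le_length_iff)
  let ?ys = "b # a # ws"
  have ys: "distinct ?ys" "set ?ys = s"
    using xs by (auto simp: xs_eq)
  have "sign_function K ori xs = - sign_function K ori ?ys"
    using alternatingD[OF alternating_\<omega>, of "[]" a b ws] by (simp add: xs_eq)
  then have "ori xs = - ori ?ys"
    using xs ys s(1) by (simp add: sign_function_def xs_eq)
  moreover have "ori xs \<in> {1, -1}"
    using ori xs s(1) unfolding invariant_orientation_def by blast
  ultimately have "ori xs = 1 \<or> ori ?ys = 1"
    by auto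
  then have ex: "\<exists>xs. distinct xs \<and> set xs = s \<and> ori xs = 1"
    using xs ys by blast
  define zs where "zs = (SOME xs. distinct xs \<and> set xs = s \<and> ori xs = 1)"
  have zs: "distinct zs" "set zs = s" "ori zs = 1"
    using someI_ex[OF ex] by (simp_all add: zs_def)
  have len: "2 \<le> length zs"
    using s(2) distinct_card[OF zs(1)] zs(2) by simp
  have "bd s = lin oriented (list_bd zs)"
    using bd_set[OF zs(1)] zs s(1) len by (auto simp: sign_function_def)
  also have "\<dots> = (\<Sum>j<length zs. let ys = take j zs @ drop (Suc j) zs in
      Poly_Mapping.single (set ys) ((-1) ^ j * real_of_int (ori ys)))"
    unfolding list_bd_eq_sum lin_of_sum
  proof (rule sum.cong[OF refl])
    fix j
    assume j: "j \<in> {..<length zs}"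
    define ys where "ys = take j zs @ drop (Suc j) zs"
    have ys: "distinct ys" "ys \<noteq> []"
      using zs(1) j len by (auto simp: ys_def set_take_disj_set_drop_if_distinct)
    moreover have "set ys \<in> K"
      using face_mono[of s "set ys"] s(1) set_take_drop_Suc[of j zs] zs(2) ys(2) by (auto simp: ys_def)
    ultimately have "sign_function K ori ys = real_of_int (ori ys)"
      by (simp add: sign_function_def)
    then have "lin oriented (Poly_Mapping.single ys ((-1) ^ j)) =
        Poly_Mapping.single (set ys) ((-1) ^ j * real_of_int (ori ys))"
      by (simp add: oriented_def scaleR_single)
    then show "lin oriented (Poly_Mapping.single (take j zs @ drop (Suc j) zs) ((-1) ^ j)) =
        (let ys = take j zs @ drop (Suc j) zs in
          Poly_Mapping.single (set ys) ((-1) ^ j * real_of_int (ori ys)))"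
      unfolding ys_def Let_def .
  qed
  finally show ?thesis
    by (simp add: boundary_def zs_def Let_def)
qed

subsection \<open>Matrices over the group algebra\<close>

lemma lookup_lin: "Poly_Mapping.lookup (lin f c) s =
    (\<Sum>a\<in>Poly_Mapping.keys c. Poly_Mapping.lookup c a * Poly_Mapping.lookup (f a) s)"
  for f :: "'a \<Rightarrow> 'b \<Rightarrow>\<^sub>0 real"
  by (simp add: lin_def lookup_sum)

lemma poly_mapping_real_induct [case_names single sum]:
  fixes c :: "'a \<Rightarrow>\<^sub>0 real"
  assumes single: "\<And>a r. P (Poly_Mapping.single a r)" and sum: "\<And>c d. P c \<Longrightarrow> P d \<Longrightarrow> P (c + d)"
  shows "P c"
proof -
  have "P (\<Sum>a\<in>A. Poly_Mapping.lookup c a *\<^sub>R Poly_Mapping.single a 1)" for A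
    by (induction A rule: infinite_finite_induct)
      (use single[of undefined 0] in \<open>simp_all add: single sum scaleR_single\<close>)
  then have "P (lin (\<lambda>a. Poly_Mapping.single a 1) c)"
    unfolding lin_def .
  then show ?thesis
    by simp
qed

lemma lookup_lin_single_inj:
  assumes "inj f"
  shows "Poly_Mapping.lookup (lin (\<lambda>a. Poly_Mapping.single (f a) (1::real)) c) (f b) =
    Poly_Mapping.lookup c b"
proof -
  have "Poly_Mapping.lookup (lin (\<lambda>a. Poly_Mapping.single (f a) (1::real)) c) (f b) =
      (\<Sum>a\<in>Poly_Mapping.keys c. if a = b then Poly_Mapping.lookup c a else 0)"
    unfolding lookup_lin using injD[OF assms]
    by (intro sum.cong refl) (auto simp: lookup_single when_def)
  then show ?thesis
    by (simp add: sum.delta' in_keys_iff)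
qed

text \<open>Degrees of \<open>S\<close> count vertices and those of \<open>k\<close> and \<tau>
  count dimension, hence the shift: \<open>S (Suc i)\<close> consists of \<open>k i\<close> free
  orbits, so its chains form a free module of rank \<open>k i\<close>.\<close>

locale based_free_resolution = free_resolution \<alpha> S d e
  for \<alpha> :: "'g::group_add \<Rightarrow> 'a \<Rightarrow> 'a" and S d e +
  fixes k :: "nat \<Rightarrow> nat" and \<tau> :: "nat \<Rightarrow> nat \<Rightarrow> 'a"
  assumes \<tau>_in: "q < k i \<Longrightarrow> \<tau> i q \<in> S (Suc i)"
    and \<tau>_cover: "s \<in> S (Suc i) \<Longrightarrow> \<exists>q<k i. \<exists>g. s = \<alpha> g (\<tau> i q)"
    and \<tau>_orbits: "q < k i \<Longrightarrow> q' < k i \<Longrightarrow> \<alpha> g (\<tau> i q) = \<alpha> h (\<tau> i q') \<Longrightarrow> q = q'"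
begin

definition smul :: "'g group_algebra \<Rightarrow> ('a \<Rightarrow>\<^sub>0 real) \<Rightarrow> ('a \<Rightarrow>\<^sub>0 real)" where
  "smul x z = lin (\<lambda>g. push \<alpha> g z) x"

text \<open>The chain with coordinate row vector \<open>v\<close> in the basis of orbit
  representatives. Scalars act from the left, so module maps become matrices acting from the
  right.\<close>

definition realize :: "nat \<Rightarrow> (nat \<Rightarrow> 'g group_algebra) \<Rightarrow> ('a \<Rightarrow>\<^sub>0 real)" where
  "realize i v = (\<Sum>q<k i. smul (v q) (Poly_Mapping.single (\<tau> i q) 1))"

lemma smul_add_right: "smul x (y + z) = smul x y + smul x z"
  by (simp add: smul_def linear_add[OF linear_push] lin_fun_add)

lemma smul_zero_right [simp]: "smul x 0 = 0"
  by (simp add: smul_def)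

lemma smul_sum_right: "smul x (sum f A) = (\<Sum>a\<in>A. smul x (f a))"
  by (induction A rule: infinite_finite_induct) (simp_all add: smul_add_right)

lemma smul_in_chain_space: "z \<in> chain_space (S n) \<Longrightarrow> smul x z \<in> chain_space (S n)"
  unfolding smul_def using push_in_chain_space[OF acts]
  by (intro lin_in_subspace[OF subspace_chain_space]) blast

lemma smul_mult:
  assumes z: "z \<in> chain_space (S n)"
  shows "smul (x * y) z = smul x (smul y z)"
proof (induction x rule: poly_mapping_real_induct)
  case (single g r)
  show ?case
  proof (induction y rule: poly_mapping_real_induct)
    case (single h s)
    then show ?case
      using push_plus[OF acts z, of g h]
      by (simp add: smul_def mult_single linear_cmul[OF linear_push])
  next
    case (sum y y')
    then show ?case
      by (simp add: distrib_left smul_def linear_add[OF linear_push] scaleR_add_right)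
  qed
next
  case (sum x x')
  then show ?case
    by (simp add: distrib_right smul_def)
qed

lemma realize_in: "realize i v \<in> chain_space (S (Suc i))"
  unfolding realize_def using \<tau>_in
  by (intro subspace_sum[OF subspace_chain_space] smul_in_chain_space single_in_chain_space) auto

lemma smul_single: "smul x (Poly_Mapping.single a 1) = lin (\<lambda>g. Poly_Mapping.single (\<alpha> g a) 1) x"
  by (simp add: smul_def)

text \<open>Different representatives have disjoint orbits, and within one orbit freeness determines
  the group element. Coordinates can thus be read off from a chain, which is how the entries of
  \<open>codiff\<close> are defined.\<close>

lemma lookup_realize:
  assumes q: "q < k i"
  shows "Poly_Mapping.lookup (realize i v) (\<alpha> g (\<tau> i q)) = Poly_Mapping.lookup (v q) g"
proof -
  have other: "Poly_Mapping.lookup (smul (v q') (Poly_Mapping.single (\<tau> i q') 1)) (\<alpha> g (\<tau> i q)) = 0"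
    if "q' < k i" "q' \<noteq> q" for q'
  proof -
    have "\<alpha> h (\<tau> i q') \<noteq> \<alpha> g (\<tau> i q)" for h
      using \<tau>_orbits[OF that(1) q] that(2) by blast
    then show ?thesis
      by (simp add: smul_single lookup_lin lookup_single when_def)
  qed
  have inj: "inj (\<lambda>g. \<alpha> g (\<tau> i q))"
    using acts_freely_onD[OF free \<tau>_in[OF q]] by (auto intro: injI)
  have "Poly_Mapping.lookup (realize i v) (\<alpha> g (\<tau> i q)) =
      (\<Sum>q'<k i. if q' = q then Poly_Mapping.lookup (v q) g else 0)"
    unfolding realize_def lookup_sum
    by (intro sum.cong refl) (auto simp: other[unfolded smul_single] smul_single lookup_lin_single_inj[OF inj])
  then show ?thesis
    using q by simp
qed

lemma realize_inj:
  assumes "realize i v = realize i w" "q < k i"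
  shows "v q = w q"
  by (rule poly_mapping_eqI) (metis assms lookup_realize)

lemma realize_lin: "realize i (\<lambda>q. lin (\<lambda>s. V s q) z) = lin (\<lambda>s. realize i (V s)) z"
  unfolding realize_def smul_def lin_lin
  by (simp add: lin_def scaleR_sum_right sum.swap[of _ "{..<k i}"])

lemma realize_surj:
  assumes z: "z \<in> chain_space (S (Suc i))"
  shows "\<exists>v. realize i v = z"
proof -
  have "\<exists>v. realize i v = Poly_Mapping.single s 1" if s: "s \<in> S (Suc i)" for s
  proof -
    obtain q g where q: "q < k i" "s = \<alpha> g (\<tau> i q)"
      using \<tau>_cover[OF s] by blast
    have "realize i (\<lambda>q'. if q' = q then Poly_Mapping.single g 1 else 0) =
        (\<Sum>q'<k i. if q' = q then smul (Poly_Mapping.single g 1) (Poly_Mapping.single (\<tau> i q) 1) else 0)"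
      unfolding realize_def by (intro sum.cong refl) (simp add: smul_def)
    also have "\<dots> = Poly_Mapping.single s 1"
      using q by (simp add: smul_def)
    finally show ?thesis
      by blast
  qed
  then obtain V where "\<And>s. s \<in> S (Suc i) \<Longrightarrow> realize i (V s) = Poly_Mapping.single s 1"
    by metis
  then have "lin (\<lambda>s. realize i (V s)) z = lin (\<lambda>s. Poly_Mapping.single s 1) z"
    by (intro lin_cong_chain_space[OF z])
  then show ?thesis
    using realize_lin[of i V z] by auto
qed

lemma smul_realize: "smul x (realize i v) = realize i (\<lambda>q. x * v q)"
  unfolding realize_def smul_sum_right
  by (intro sum.cong refl smul_mult[where n = "Suc i", symmetric] single_in_chain_space \<tau>_in) simp

lemma realize_sum: "(\<Sum>p\<in>P. realize i (v p)) = realize i (\<lambda>q. \<Sum>p\<in>P. v p q)"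
  unfolding realize_def smul_def by (subst sum.swap) (simp add: lin_of_sum)

text \<open>An equivariant map is determined by its values on the representatives; with their
  coordinates as the rows of \<open>M\<close>, it becomes multiplication by \<open>M\<close> on the
  right.\<close>

lemma lin_realize:
  assumes equivariant: "\<And>a g. a \<in> S (Suc i) \<Longrightarrow> \<Theta> (\<alpha> g a) = push \<alpha> g (\<Theta> a)"
    and M: "\<And>p. p < k i \<Longrightarrow> realize j (M p) = \<Theta> (\<tau> i p)"
  shows "lin \<Theta> (realize i v) = realize j (\<lambda>q. \<Sum>p<k i. v p * M p q)"
proof -
  have "lin \<Theta> (smul (v p) (Poly_Mapping.single (\<tau> i p) 1)) = realize j (\<lambda>q. v p * M p q)"
    if "p < k i" for p
    using equivariant[OF \<tau>_in[OF that]]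
    by (simp add: smul_single lin_lin smul_realize[symmetric] M[OF that]) (simp add: smul_def)
  then have "lin \<Theta> (realize i v) = (\<Sum>p<k i. realize j (\<lambda>q. v p * M p q))"
    unfolding realize_def[of i] lin_of_sum by simp
  then show ?thesis
    by (simp add: realize_sum)
qed

lemma lin_realize_mat:
  assumes "\<And>a g. a \<in> S (Suc i) \<Longrightarrow> \<Theta> (\<alpha> g a) = push \<alpha> g (\<Theta> a)"
    and "\<And>p. p < k i \<Longrightarrow> realize j (\<lambda>q. M $$ (p, q)) = \<Theta> (\<tau> i p)"
    and A: "A \<in> carrier_mat m (k i)" and M: "M \<in> carrier_mat (k i) (k j)" and r: "r < m"
  shows "realize j (\<lambda>q. (A * M) $$ (r, q)) = lin \<Theta> (realize i (\<lambda>p. A $$ (r, p)))"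
proof -
  have "(A * M) $$ (r, q) = (\<Sum>p<k i. A $$ (r, p) * M $$ (p, q))" if "q < k j" for q
    using A M r that by (simp add: scalar_prod_def atLeast0LessThan)
  then have "realize j (\<lambda>q. (A * M) $$ (r, q)) = realize j (\<lambda>q. \<Sum>p<k i. A $$ (r, p) * M $$ (p, q))"
    by (simp add: realize_def)
  then show ?thesis
    using lin_realize[OF assms(1,2)] by simp
qed

lemma mat_eqI_realize:
  assumes "A \<in> carrier_mat m (k i)" "B \<in> carrier_mat m (k i)"
    and "\<And>r. r < m \<Longrightarrow> realize i (\<lambda>q. A $$ (r, q)) = realize i (\<lambda>q. B $$ (r, q))"
  shows "A = B"
  using assms realize_inj[OF assms(3)] by (intro eq_matI) auto

lemma realize_zero_mat: "r < m \<Longrightarrow> realize i (\<lambda>q. 0\<^sub>m m (k i) $$ (r, q)) = 0"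
  by (simp add: realize_def smul_def)

section \<open>Codifferential matrices: exactness and contraction\<close>

context
  fixes D :: "nat \<Rightarrow> 'g group_algebra mat"
  assumes D_carrier: "D i \<in> carrier_mat (k (Suc i)) (k i)"
    and D_realize: "p < k (Suc i) \<Longrightarrow> realize i (\<lambda>q. D i $$ (p, q)) = d (\<tau> (Suc i) p)"
begin

lemma realize_mult_D:
  assumes "A \<in> carrier_mat m (k (Suc i))" "r < m"
  shows "realize i (\<lambda>q. (A * D i) $$ (r, q)) = lin d (realize (Suc i) (\<lambda>p. A $$ (r, p)))"
  using d_equivariant D_realize assms(1) D_carrier assms(2) by (rule lin_realize_mat)

lemma D_mult_D: "D (Suc i) * D i = 0\<^sub>m (k (Suc (Suc i))) (k i)"
proof (rule mat_eqI_realize)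
  show "D (Suc i) * D i \<in> carrier_mat (k (Suc (Suc i))) (k i)"
    using D_carrier by (rule mult_carrier_mat) (rule D_carrier)
  fix r
  assume r: "r < k (Suc (Suc i))"
  have "realize i (\<lambda>q. (D (Suc i) * D i) $$ (r, q)) = lin d (d (\<tau> (Suc (Suc i)) r))"
    using realize_mult_D[OF D_carrier r] D_realize[OF r] by simp
  then show "realize i (\<lambda>q. (D (Suc i) * D i) $$ (r, q)) =
      realize i (\<lambda>q. 0\<^sub>m (k (Suc (Suc i))) (k i) $$ (r, q))"
    using d_d[OF \<tau>_in[OF r]] realize_zero_mat[OF r] by simp
qed simp

text \<open>Each row of \<open>V\<close> is the coordinate vector of a cycle, and preimages are
  chosen row by row. The number of rows is therefore arbitrary, as the zigzag requires.\<close>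

lemma D_exact:
  assumes V: "V \<in> carrier_mat m (k (Suc i))" "V * D i = 0\<^sub>m m (k i)"
  shows "\<exists>Y\<in>carrier_mat m (k (Suc (Suc i))). Y * D (Suc i) = V"
proof -
  have "\<exists>y. realize (Suc i) (\<lambda>q. V $$ (r, q)) = lin d (realize (Suc (Suc i)) y)" if r: "r < m" for r
  proof -
    have "lin d (realize (Suc i) (\<lambda>q. V $$ (r, q))) = 0"
      using realize_mult_D[OF V(1) r] realize_zero_mat[OF r, of i] V(2) by simp
    then obtain c where "c \<in> chain_space (S (Suc (Suc (Suc i))))" "lin d c = realize (Suc i) (\<lambda>q. V $$ (r, q))"
      using exact[OF realize_in] by blast
    then show ?thesis
      using realize_surj[of c "Suc (Suc i)"] by metis
  qed
  then obtain y where y: "\<And>r. r < m \<Longrightarrow>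
      realize (Suc i) (\<lambda>q. V $$ (r, q)) = lin d (realize (Suc (Suc i)) (y r))"
    by metis
  define Y where "Y = mat m (k (Suc (Suc i))) (\<lambda>(r, q). y r q)"
  have Y: "Y \<in> carrier_mat m (k (Suc (Suc i)))"
    by (simp add: Y_def)
  have "Y * D (Suc i) = V"
  proof (rule mat_eqI_realize[OF _ V(1)])
    show "Y * D (Suc i) \<in> carrier_mat m (k (Suc i))"
      using Y D_carrier by (rule mult_carrier_mat)
    fix r
    assume r: "r < m"
    have "realize (Suc (Suc i)) (\<lambda>q. Y $$ (r, q)) = realize (Suc (Suc i)) (y r)"
      using r by (simp add: realize_def Y_def)
    then show "realize (Suc i) (\<lambda>q. (Y * D (Suc i)) $$ (r, q)) = realize (Suc i) (\<lambda>q. V $$ (r, q))"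
      using realize_mult_D[OF Y r] y[OF r] by simp
  qed
  then show ?thesis
    using Y by blast
qed

text \<open>\<open>N\<close> counts vertices, whereas the identity matrix belongs to simplices of
  dimension \<open>Suc i\<close>, which have \<open>Suc (Suc i)\<close> vertices.\<close>

lemma D_contraction_above:
  fixes \<beta> :: "'g \<Rightarrow> 'b \<Rightarrow> 'b"
  assumes B: "free_resolution \<beta> B dB b0" and B_empty: "\<And>n. N \<le> n \<Longrightarrow> B n = {}"
  shows "\<exists>H. (\<forall>i. H i \<in> carrier_mat (k i) (k (Suc i))) \<and>
    (\<forall>i. N \<le> Suc (Suc i) \<longrightarrow> D i * H i + H (Suc i) * D (Suc i) = 1\<^sub>m (k (Suc i)))"
proof -
  obtain h where h: "\<And>n a. a \<in> S n \<Longrightarrow> h n a \<in> chain_space (S (Suc n))"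
    "\<And>n a g. a \<in> S n \<Longrightarrow> h n (\<alpha> g a) = push \<alpha> g (h n a)"
    "\<And>n a. N \<le> Suc n \<Longrightarrow> a \<in> S (Suc n) \<Longrightarrow> lin d (h (Suc n) a) = Poly_Mapping.single a 1 - lin (h n) (d a)"
    using equivariant_contraction_above[OF free_resolution_axioms B B_empty] by blast
  define v where "v i p = (SOME v. realize (Suc i) v = h (Suc i) (\<tau> i p))" for i p
  have v: "realize (Suc i) (v i p) = h (Suc i) (\<tau> i p)" if "p < k i" for i p
    unfolding v_def using someI_ex[OF realize_surj[OF h(1)[OF \<tau>_in[OF that]]]] .
  define H where "H i = mat (k i) (k (Suc i)) (\<lambda>(p, q). v i p q)" for i
  have H: "H i \<in> carrier_mat (k i) (k (Suc i))" for i
    by (simp add: H_def)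
  have H_realize: "realize (Suc i) (\<lambda>q. H i $$ (p, q)) = h (Suc i) (\<tau> i p)" if "p < k i" for i p
  proof -
    have "realize (Suc i) (\<lambda>q. H i $$ (p, q)) = realize (Suc i) (v i p)"
      using that by (simp add: realize_def H_def)
    then show ?thesis
      using v[OF that] by simp
  qed
  have "D i * H i + H (Suc i) * D (Suc i) = 1\<^sub>m (k (Suc i))" if N: "N \<le> Suc (Suc i)" for i
  proof (rule mat_eqI_realize)
    have c: "D i * H i \<in> carrier_mat (k (Suc i)) (k (Suc i))"
      "H (Suc i) * D (Suc i) \<in> carrier_mat (k (Suc i)) (k (Suc i))"
      using D_carrier H by (auto intro: mult_carrier_mat)
    then show "D i * H i + H (Suc i) * D (Suc i) \<in> carrier_mat (k (Suc i)) (k (Suc i))"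
      by simp
    fix r
    assume r: "r < k (Suc i)"
    have "realize (Suc i) (\<lambda>q. (D i * H i) $$ (r, q)) = lin (h (Suc i)) (d (\<tau> (Suc i) r))"
      using lin_realize_mat[OF h(2) H_realize D_carrier H r] D_realize[OF r] by simp
    moreover have "realize (Suc i) (\<lambda>q. (H (Suc i) * D (Suc i)) $$ (r, q)) =
        lin d (h (Suc (Suc i)) (\<tau> (Suc i) r))"
      using realize_mult_D[OF H r] H_realize[OF r] by simp
    moreover have "realize (Suc i) (\<lambda>q. (D i * H i + H (Suc i) * D (Suc i)) $$ (r, q)) =
        realize (Suc i) (\<lambda>q. (D i * H i) $$ (r, q)) + realize (Suc i) (\<lambda>q. (H (Suc i) * D (Suc i)) $$ (r, q))"
    proof -
      have "(D i * H i + H (Suc i) * D (Suc i)) $$ (r, q) =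
          (D i * H i) $$ (r, q) + (H (Suc i) * D (Suc i)) $$ (r, q)" if "q < k (Suc i)" for q
        using r that carrier_matD[OF c(2)] by (intro index_add_mat(1)) simp_all
      then show ?thesis
        by (simp add: realize_def smul_def flip: sum.distrib)
    qed
    moreover have "realize (Suc i) (\<lambda>q. 1\<^sub>m (k (Suc i)) $$ (r, q)) = Poly_Mapping.single (\<tau> (Suc i) r) 1"
    proof -
      have "realize (Suc i) (\<lambda>q. 1\<^sub>m (k (Suc i)) $$ (r, q)) =
          (\<Sum>q<k (Suc i). if q = r then smul 1 (Poly_Mapping.single (\<tau> (Suc i) r) 1) else 0)"
        unfolding realize_def using r by (intro sum.cong refl) (auto simp: smul_def)
      also have "\<dots> = Poly_Mapping.single (\<tau> (Suc i) r) 1"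
        using r acts[of "Suc (Suc i)"] \<tau>_in[OF r] by (simp add: smul_def acts_on_def flip: single_one)
      finally show ?thesis .
    qed
    ultimately show "realize (Suc i) (\<lambda>q. (D i * H i + H (Suc i) * D (Suc i)) $$ (r, q)) =
        realize (Suc i) (\<lambda>q. 1\<^sub>m (k (Suc i)) $$ (r, q))"
      using h(3)[OF N \<tau>_in[OF r]] by simp
  qed simp
  then show ?thesis
    using H by blast
qed

end

end

subsection \<open>The split conjugation space\<close>

lemma lookup_ga_star: "Poly_Mapping.lookup (ga_star a) g = Poly_Mapping.lookup a (- g)"
  unfolding ga_star_def by (simp add: map_key.rep_eq inj_def)

lemma ga_star_add: "ga_star (a + b) = ga_star a + ga_star b"
  by (rule poly_mapping_eqI) (simp add: lookup_ga_star lookup_add)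

lemma ga_star_0 [simp]: "ga_star 0 = 0"
  by (rule poly_mapping_eqI) (simp add: lookup_ga_star)

lemma ga_star_ga_star [simp]: "ga_star (ga_star a) = a"
  by (rule poly_mapping_eqI) (simp add: lookup_ga_star)

lemma ga_star_single: "ga_star (Poly_Mapping.single g r) = Poly_Mapping.single (- g) r"
  by (rule poly_mapping_eqI) (auto simp: lookup_ga_star lookup_single when_def)

lemma ga_star_1 [simp]: "ga_star 1 = 1"
  by (simp add: ga_star_single flip: single_one)

lemma ga_star_sum: "ga_star (sum f A) = (\<Sum>x\<in>A. ga_star (f x))"
  by (induction A rule: infinite_finite_induct) (simp_all add: ga_star_add)

lemma ga_star_mult: "ga_star (a * b) = ga_star b * ga_star a"
proof (induction a rule: poly_mapping_real_induct)
  case (single g r)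
  show ?case
  proof (induction b rule: poly_mapping_real_induct)
    case (single h s)
    then show ?case
      by (simp add: mult_single ga_star_single minus_add mult.commute)
  qed (simp add: distrib_left distrib_right ga_star_add)
qed (simp add: distrib_left distrib_right ga_star_add)

lemma mat_star_carrier: "A \<in> carrier_mat m n \<Longrightarrow> mat_star A \<in> carrier_mat n m"
  by (auto simp: mat_star_def)

lemma mat_star_mat_star [simp]: "mat_star (mat_star A) = A"
  unfolding mat_star_def by (intro eq_matI) auto

lemma mat_star_add:
  assumes "A \<in> carrier_mat m n" "B \<in> carrier_mat m n"
  shows "mat_star (A + B) = mat_star A + mat_star B"
  unfolding mat_star_def using assms by (intro eq_matI) (auto simp: ga_star_add)

lemma mat_star_zero [simp]: "mat_star (0\<^sub>m m n) = 0\<^sub>m n m"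
  unfolding mat_star_def by (intro eq_matI) auto

lemma mat_star_one [simp]: "mat_star (1\<^sub>m n) = 1\<^sub>m n"
  unfolding mat_star_def by (intro eq_matI) auto

lemma mat_star_mult:
  assumes A: "A \<in> carrier_mat m n" and B: "B \<in> carrier_mat n l"
  shows "mat_star (A * B) = mat_star B * mat_star A"
proof (rule eq_matI)
  fix i j
  assume "i < dim_row (mat_star B * mat_star A)" "j < dim_col (mat_star B * mat_star A)"
  then have ij: "i < l" "j < m"
    using A B by (auto simp: mat_star_def)
  have "mat_star (A * B) $$ (i, j) = ga_star (\<Sum>p<n. A $$ (j, p) * B $$ (p, i))"
    using A B ij by (simp add: mat_star_def scalar_prod_def atLeast0LessThan)
  also have "\<dots> = (\<Sum>p<n. ga_star (B $$ (p, i)) * ga_star (A $$ (j, p)))"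
    by (simp add: ga_star_sum ga_star_mult)
  also have "\<dots> = (mat_star B * mat_star A) $$ (i, j)"
    using A B ij by (simp add: mat_star_def scalar_prod_def atLeast0LessThan)
  finally show "mat_star (A * B) $$ (i, j) = (mat_star B * mat_star A) $$ (i, j)" .
qed (use A B in \<open>auto simp: mat_star_def\<close>)

section \<open>The zigzag in the double complex\<close>

context
  fixes D H :: "nat \<Rightarrow> 'g::group_add group_algebra mat" and k :: "nat \<Rightarrow> nat" and n :: nat
  assumes D: "D i \<in> carrier_mat (k (Suc i)) (k i)"
    and H: "H i \<in> carrier_mat (k i) (k (Suc i))"
    and DD: "D (Suc i) * D i = 0\<^sub>m (k (Suc (Suc i))) (k i)"
    and exact: "V \<in> carrier_mat m (k (Suc i)) \<Longrightarrow> V * D i = 0\<^sub>m m (k i) \<Longrightarrow>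
      \<exists>Y\<in>carrier_mat m (k (Suc (Suc i))). Y * D (Suc i) = V"
    and contraction: "n \<le> i \<Longrightarrow> D i * H i + H (Suc i) * D (Suc i) = 1\<^sub>m (k (Suc i))"
begin

lemma D_star: "mat_star (D i) \<in> carrier_mat (k i) (k (Suc i))"
  using D by (rule mat_star_carrier)

lemma D_star_D_star: "mat_star (D i) * mat_star (D (Suc i)) = 0\<^sub>m (k i) (k (Suc (Suc i)))"
  using mat_star_mult[OF D D, of i] by (simp add: DD)

text \<open>Moves \<open>a\<close> along the diagonal of the double complex of matrices, from \<open>(p + 1, q)\<close> to
  \<open>(p + q + 1, 0)\<close>, where the contraction applies, and back.\<close>

lemma split_of_star_mult:
  assumes "a \<in> carrier_mat (k (Suc p)) (k q)" "n \<le> p + q"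
    and "y \<in> carrier_mat (k p) (k (Suc q))" "mat_star (D p) * a = y * D q"
  shows "\<exists>x\<in>carrier_mat (k (Suc (Suc p))) (k q). \<exists>y\<in>carrier_mat (k (Suc p)) (k (Suc q)).
    a = mat_star (D (Suc p)) * x + y * D q"
  using assms
proof (induction q arbitrary: p a y)
  case 0
  note a = 0(1) and y = 0(3)
  have Hs: "mat_star (H i) \<in> carrier_mat (k (Suc i)) (k i)" for i
    using H by (rule mat_star_carrier)
  \<comment> \<open>The starred contraction acts from the left and decomposes \<open>a\<close>. In
    the summand containing \<open>mat_star (D p) * a\<close>, the hypothesis puts a factor
    \<open>D 0\<close> on the right.\<close>
  have "mat_star (H p) * mat_star (D p) + mat_star (D (Suc p)) * mat_star (H (Suc p)) =
      mat_star (D p * H p + H (Suc p) * D (Suc p))"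
    using mat_star_mult[OF D H, of p] mat_star_mult[OF H D, of "Suc p"]
      mat_star_add[OF mult_carrier_mat[OF D H] mult_carrier_mat[OF H D], of p] by simp
  also have "\<dots> = 1\<^sub>m (k (Suc p))"
    using contraction[of p] 0(2) by simp
  finally have "a = (mat_star (H p) * mat_star (D p) + mat_star (D (Suc p)) * mat_star (H (Suc p))) * a"
    using a by simp
  also have "\<dots> = mat_star (H p) * mat_star (D p) * a + mat_star (D (Suc p)) * mat_star (H (Suc p)) * a"
    using mult_carrier_mat[OF Hs D_star] mult_carrier_mat[OF D_star Hs] a by (rule add_mult_distrib_mat)
  also have "mat_star (H p) * mat_star (D p) * a = mat_star (H p) * y * D 0"
    using assoc_mult_mat[OF Hs D_star a] assoc_mult_mat[OF Hs y D] 0(4) by simp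
  also have "mat_star (D (Suc p)) * mat_star (H (Suc p)) * a =
      mat_star (D (Suc p)) * (mat_star (H (Suc p)) * a)"
    using D_star Hs a by (rule assoc_mult_mat)
  also have "mat_star (H p) * y * D 0 + mat_star (D (Suc p)) * (mat_star (H (Suc p)) * a) =
      mat_star (D (Suc p)) * (mat_star (H (Suc p)) * a) + mat_star (H p) * y * D 0"
    using mult_carrier_mat[OF mult_carrier_mat[OF Hs y] D]
      mult_carrier_mat[OF D_star mult_carrier_mat[OF Hs a]] by (rule comm_add_mat)
  finally show ?case
    using mult_carrier_mat[OF Hs a] mult_carrier_mat[OF Hs y] by blast
next
  case (Suc q)
  note a = Suc.prems(1) and y = Suc.prems(3)
  have b: "a * D q \<in> carrier_mat (k (Suc p)) (k q)"
    using a D by (rule mult_carrier_mat)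
  have "mat_star (D p) * (a * D q) = mat_star (D p) * a * D q"
    using assoc_mult_mat[OF D_star a D] by simp
  also have "\<dots> = y * (D (Suc q) * D q)"
    using assoc_mult_mat[OF y D D] Suc.prems(4) by simp
  also have "\<dots> = 0\<^sub>m (k p) (k q)"
    using y by (simp add: DD)
  finally have "mat_star (a * D q) * D p = 0\<^sub>m (k q) (k p)"
    using mat_star_mult[OF D_star b] by simp
  \<comment> \<open>Exactness is available for multiplication from the right, so it is applied to
    the starred equation; starring \<open>Y\<close> gives the preimage in the column
    direction.\<close>
  then obtain Y where Y: "Y \<in> carrier_mat (k q) (k (Suc (Suc p)))" "Y * D (Suc p) = mat_star (a * D q)"
    using exact[OF mat_star_carrier[OF b]] by blast
  define a' where "a' = mat_star Y"
  have a': "a' \<in> carrier_mat (k (Suc (Suc p))) (k q)"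
    unfolding a'_def using Y(1) by (rule mat_star_carrier)
  have eq: "mat_star (D (Suc p)) * a' = a * D q"
    using mat_star_mult[OF Y(1) D] Y(2) by (simp add: a'_def)
  \<comment> \<open>The relation for \<open>a'\<close> is the hypothesis of the claim one step along
    the antidiagonal, with \<open>a\<close> itself in the role of \<open>y\<close>; the sum of the
    two indices is unchanged, so the bound persists.\<close>
  obtain x' y' where x': "x' \<in> carrier_mat (k (Suc (Suc (Suc p)))) (k q)"
    and y': "y' \<in> carrier_mat (k (Suc (Suc p))) (k (Suc q))"
    and split: "a' = mat_star (D (Suc (Suc p))) * x' + y' * D q"
    using Suc.IH[OF a' _ a eq] Suc.prems(2) by auto
  have c: "mat_star (D (Suc p)) * y' \<in> carrier_mat (k (Suc p)) (k (Suc q))"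
    using D_star y' by (rule mult_carrier_mat)
  \<comment> \<open>Two consecutive starred codifferentials compose to zero, so only
    \<open>y'\<close> contributes. Subtracting its contribution from \<open>a\<close> leaves a
    matrix annihilated by \<open>D q\<close>, and exactness writes this as a multiple of
    \<open>D (Suc q)\<close>.\<close>
  have "a * D q = mat_star (D (Suc p)) * (mat_star (D (Suc (Suc p))) * x') +
      mat_star (D (Suc p)) * (y' * D q)"
    unfolding eq[symmetric] split
    using D_star mult_carrier_mat[OF D_star x'] mult_carrier_mat[OF y' D] by (rule mult_add_distrib_mat)
  also have "mat_star (D (Suc p)) * (mat_star (D (Suc (Suc p))) * x') = 0\<^sub>m (k (Suc p)) (k q)"
    using assoc_mult_mat[OF D_star D_star x'] x' by (simp add: D_star_D_star)
  also have "mat_star (D (Suc p)) * (y' * D q) = mat_star (D (Suc p)) * y' * D q"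
    using assoc_mult_mat[OF D_star y' D] by simp
  also have "0\<^sub>m (k (Suc p)) (k q) + mat_star (D (Suc p)) * y' * D q = mat_star (D (Suc p)) * y' * D q"
    using mult_carrier_mat[OF c D] by simp
  finally have aD: "a * D q = mat_star (D (Suc p)) * y' * D q" .
  have "(a - mat_star (D (Suc p)) * y') * D q = a * D q - mat_star (D (Suc p)) * y' * D q"
    using a c D by (rule minus_mult_distrib_mat)
  also have "\<dots> = 0\<^sub>m (k (Suc p)) (k q)"
    unfolding aD using mult_carrier_mat[OF c D] by simp
  finally obtain z where z: "z \<in> carrier_mat (k (Suc p)) (k (Suc (Suc q)))"
    "z * D (Suc q) = a - mat_star (D (Suc p)) * y'"
    using exact[OF minus_carrier_mat[OF c, of a]] by blast
  have "a = mat_star (D (Suc p)) * y' + z * D (Suc q)"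
    unfolding z(2) using a c by (intro eq_matI) auto
  then show ?case
    using y' z(1) by blast
qed

text \<open>Right exactness turns the kernel condition into the starting relation of the zigzag with
  p = j and q = j + 1, whence the bound 2 j + 1. The converse comes from consecutive codifferentials
  composing to zero on either side.\<close>

lemma conj_eq_zero_iff_split:
  assumes "n \<le> 2 * j + 1" and a: "a \<in> carrier_mat (k (Suc j)) (k (Suc j))"
  shows "mat_star (D j) * a * D j = 0\<^sub>m (k j) (k j) \<longleftrightarrow>
    (\<exists>x\<in>carrier_mat (k (Suc (Suc j))) (k (Suc j)). \<exists>y\<in>carrier_mat (k (Suc j)) (k (Suc (Suc j))).
      a = mat_star (D (Suc j)) * x + y * D (Suc j))"
proof
  assume 0: "mat_star (D j) * a * D j = 0\<^sub>m (k j) (k j)"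
  then obtain y where "y \<in> carrier_mat (k j) (k (Suc (Suc j)))" "mat_star (D j) * a = y * D (Suc j)"
    using exact[OF mult_carrier_mat[OF D_star a]] by metis
  then show "\<exists>x\<in>carrier_mat (k (Suc (Suc j))) (k (Suc j)). \<exists>y\<in>carrier_mat (k (Suc j)) (k (Suc (Suc j))).
      a = mat_star (D (Suc j)) * x + y * D (Suc j)"
    using split_of_star_mult[OF a] assms(1) by simp
next
  assume "\<exists>x\<in>carrier_mat (k (Suc (Suc j))) (k (Suc j)). \<exists>y\<in>carrier_mat (k (Suc j)) (k (Suc (Suc j))).
      a = mat_star (D (Suc j)) * x + y * D (Suc j)"
  then obtain x y where x: "x \<in> carrier_mat (k (Suc (Suc j))) (k (Suc j))"
    and y: "y \<in> carrier_mat (k (Suc j)) (k (Suc (Suc j)))"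
    and split: "a = mat_star (D (Suc j)) * x + y * D (Suc j)"
    by blast
  have "mat_star (D j) * a = mat_star (D j) * (mat_star (D (Suc j)) * x) + mat_star (D j) * (y * D (Suc j))"
    unfolding split using D_star mult_carrier_mat[OF D_star x] mult_carrier_mat[OF y D]
    by (rule mult_add_distrib_mat)
  also have "mat_star (D j) * (mat_star (D (Suc j)) * x) = 0\<^sub>m (k j) (k (Suc j))"
    using assoc_mult_mat[OF D_star D_star x] x by (simp add: D_star_D_star)
  also have "mat_star (D j) * (y * D (Suc j)) = mat_star (D j) * y * D (Suc j)"
    using assoc_mult_mat[OF D_star y D] by simp
  also have "0\<^sub>m (k j) (k (Suc j)) + mat_star (D j) * y * D (Suc j) = mat_star (D j) * y * D (Suc j)"
    using mult_carrier_mat[OF mult_carrier_mat[OF D_star y] D] by simp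
  finally show "mat_star (D j) * a * D j = 0\<^sub>m (k j) (k j)"
    using assoc_mult_mat[OF mult_carrier_mat[OF D_star y] D D]
      right_mult_zero_mat[OF mult_carrier_mat[OF D_star y]] by (simp add: DD)
qed

end

theorem theorem3p3:
  fixes act :: "'g::group_add \<Rightarrow> 'v \<Rightarrow> 'v"
    and X :: "'v set set"
    and ori :: "'v list \<Rightarrow> int"
    and \<tau> :: "nat \<Rightarrow> nat \<Rightarrow> 'v set"
    and n i :: nat
  assumes "type_F_complex act X"
    and "geometric_dimension_le TYPE('w) TYPE('g) n"
    and "invariant_orientation act X ori"
    and "orbit_representatives act X \<tau>"
    and "real i \<ge> (real n + 1) / 2"
  shows "ker_conj_map act X ori \<tau> (i - 1) = split_conjugation_space act X ori \<tau> i"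
proof -
  have X: "free_contractible_complex act X"
    using assms(1) by (simp add: type_F_complex_def)
  then have complex: "abstract_simplicial_complex X" and act: "simplicial_action act X"
    by (simp_all add: free_contractible_complex_def)
  define k where "k = num_orbits act X"
  define D where "D = codiff act X ori \<tau>"
  interpret oriented_complex X "sign_function X ori"
    by (rule oriented_complex_sign_function[OF complex assms(3)])
  have faces_Suc: "faces (Suc j) = simplices X j" for j
    by (auto simp: faces_def simplices_def)
  interpret based_free_resolution "\<lambda>g s. act g ` s" faces bd "{}" k \<tau>
  proof (intro based_free_resolution.intro based_free_resolution_axioms.intro)
    show "free_resolution (\<lambda>g s. act g ` s) faces bd {}"
      by (rule free_resolution_faces[OF X assms(3)])
    fix q q' j g h s
    have bij: "bij_betw (\<lambda>p. simplex_orbit act (\<tau> j p)) {..<k j} (simplex_orbit act ` simplices X j)"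
      using assms(4) unfolding orbit_representatives_def k_def by blast
    show \<tau>: "\<tau> j q \<in> faces (Suc j)" if "q < k j" for q
      using assms(4) that unfolding orbit_representatives_def k_def faces_Suc by blast
    have act_X: "acts_on (\<lambda>g s. act g ` s) X"
      by (rule acts_on_simplices[OF act])
    show "\<exists>q<k j. \<exists>g. s = act g ` \<tau> j q" if "s \<in> faces (Suc j)"
    proof -
      have "simplex_orbit act s \<in> (\<lambda>p. simplex_orbit act (\<tau> j p)) ` {..<k j}"
        using bij that unfolding bij_betw_def faces_Suc by blast
      then obtain q where q: "q < k j" "simplex_orbit act s = simplex_orbit act (\<tau> j q)"
        by blast
      have "s = act 0 ` s"
        using act_X that by (simp add: acts_on_def faces_Suc simplices_def)
      then have "s \<in> simplex_orbit act s"
        unfolding simplex_orbit_def by (rule range_eqI)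
      then have "s \<in> range (\<lambda>g. act g ` \<tau> j q)"
        unfolding q(2) by (simp only: simplex_orbit_def)
      then obtain g where "s = act g ` \<tau> j q"
        by (rule rangeE)
      with q(1) show ?thesis
        by (intro exI[of _ q] exI[of _ g] conjI)
    qed
    show "q = q'" if q: "q < k j" "q' < k j" and eq: "act g ` \<tau> j q = act h ` \<tau> j q'"
    proof -
      have orbit: "simplex_orbit act (act g ` s) = simplex_orbit act s" if s: "s \<in> X" for g s
      proof -
        have plus: "act (g + h) ` s = act g ` act h ` s" for g h
          using act_X s by (simp add: acts_on_def)
        have "act h ` act g ` s \<in> simplex_orbit act s" for h
          unfolding simplex_orbit_def plus[symmetric] by (rule rangeI)
        moreover have "act h ` s = act (h - g) ` act g ` s" for h
          using plus[of "h - g" g] by simp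
        then have "act h ` s \<in> simplex_orbit act (act g ` s)" for h
          unfolding simplex_orbit_def by (rule range_eqI)
        ultimately show ?thesis
          unfolding simplex_orbit_def by (intro subset_antisym image_subsetI)
      qed
      have "\<tau> j q \<in> X" "\<tau> j q' \<in> X"
        using \<tau>[OF q(1)] \<tau>[OF q(2)] by (simp_all add: faces_Suc simplices_def)
      then have "simplex_orbit act (\<tau> j q) = simplex_orbit act (\<tau> j q')"
        using orbit eq by metis
      then show ?thesis
        using bij q unfolding bij_betw_def by (auto dest: inj_onD)
    qed
  qed
  have D_carrier: "D j \<in> carrier_mat (k (Suc j)) (k j)" for j
    by (simp add: D_def codiff_def k_def)
  have D_realize: "realize j (\<lambda>q. D j $$ (p, q)) = bd (\<tau> (Suc j) p)" if p: "p < k (Suc j)" for j p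
  proof -
    have \<tau>_p: "\<tau> (Suc j) p \<in> X" "card (\<tau> (Suc j) p) = Suc (Suc j)"
      using \<tau>_in[OF p] by (simp_all add: faces_Suc simplices_def)
    then have boundary: "boundary ori (\<tau> (Suc j) p) = bd (\<tau> (Suc j) p)"
      by (intro boundary_eq_bd[OF complex assms(3)]) simp_all
    \<comment> \<open>The coordinates of the boundary chain are its coefficients at the translates
      of the representatives, and those coefficients are exactly what \<open>codiff\<close>
      collects.\<close>
    obtain v where v: "realize j v = bd (\<tau> (Suc j) p)"
      using realize_surj[OF bd_in_chain_space[OF \<tau>_in[OF p]]] by blast
    have "D j $$ (p, q) = v q" if q: "q < k j" for q
    proof -
      have "D j $$ (p, q) = (\<Sum>\<gamma> | Poly_Mapping.lookup (v q) \<gamma> \<noteq> 0.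
          Poly_Mapping.single \<gamma> (Poly_Mapping.lookup (v q) \<gamma>))"
        using p q lookup_realize[OF q, of v]
        by (simp add: D_def codiff_def k_def[symmetric] boundary v Let_def)
      also have "\<dots> = lin (\<lambda>\<gamma>. Poly_Mapping.single \<gamma> 1) (v q)"
        unfolding lin_def keys.rep_eq by (simp add: scaleR_single)
      finally show ?thesis
        by simp
    qed
    then have "realize j (\<lambda>q. D j $$ (p, q)) = realize j v"
      by (simp add: realize_def)
    then show ?thesis
      by (simp add: v)
  qed
  obtain act' :: "'g \<Rightarrow> 'w \<Rightarrow> 'w" and K where K: "free_contractible_complex act' K" "dimension_le K n"
    using assms(2) unfolding geometric_dimension_le_def by blast
  \<comment> \<open>The comparison complex comes without an orientation; its free action provides
    one.\<close>
  then obtain ori' where ori': "invariant_orientation act' K ori'"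
    using ex_invariant_orientation unfolding free_contractible_complex_def by blast
  interpret K: oriented_complex K "sign_function K ori'"
    using K(1) by (intro oriented_complex_sign_function[OF _ ori']) (simp add: free_contractible_complex_def)
  have K_empty: "K.faces m = {}" if "n + 2 \<le> m" for m
    using K(2) that by (fastforce simp: K.faces_def dimension_le_def)
  \<comment> \<open>Dimension at most \<open>n\<close> means at most \<open>n + 1\<close> vertices,
    so the comparison chains vanish from vertex degree \<open>n + 2\<close> on. This gives the
    contraction on simplices of dimension \<open>Suc j\<close> for all \<open>j\<close> with
    \<open>n \<le> j\<close>.\<close>
  obtain H where H: "\<And>j. H j \<in> carrier_mat (k j) (k (Suc j))"
    "\<And>j. n \<le> j \<Longrightarrow> D j * H j + H (Suc j) * D (Suc j) = 1\<^sub>m (k (Suc j))"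
    using D_contraction_above[where D = D and N = "n + 2", OF D_carrier D_realize free_resolution_faces[OF K(1) ori'] K_empty]
    by auto
  have "1 \<le> i"
    using assms(5) by (cases i) auto
  then obtain j where j: "i = Suc j"
    by (metis Suc_le_D One_nat_def)
  \<comment> \<open>The hypothesis amounts to 2 i \<ge> n + 1; with i = j + 1 this is n \<le> 2 j +
    1, the bound of the zigzag.\<close>
  have "real (n + 1) \<le> real (2 * i)"
    using assms(5) by simp
  then have "n \<le> 2 * j + 1"
    unfolding of_nat_le_iff j by simp
  have iff: "mat_star (D j) * a * D j = 0\<^sub>m (k j) (k j) \<longleftrightarrow>
    (\<exists>x\<in>carrier_mat (k (Suc (Suc j))) (k (Suc j)). \<exists>y\<in>carrier_mat (k (Suc j)) (k (Suc (Suc j))).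
      a = mat_star (D (Suc j)) * x + y * D (Suc j))" if "a \<in> carrier_mat (k (Suc j)) (k (Suc j))" for a
    using D_carrier H(1) D_mult_D[where D = D, OF D_carrier D_realize]
      D_exact[where D = D, OF D_carrier D_realize] H(2) \<open>n \<le> 2 * j + 1\<close> that
    by (rule conj_eq_zero_iff_split)
  have "mat_star (D (Suc j)) * x + y * D (Suc j) \<in> carrier_mat (k (Suc j)) (k (Suc j))"
    if "y \<in> carrier_mat (k (Suc j)) (k (Suc (Suc j)))" for x y
    using mult_carrier_mat[OF that D_carrier] by simp
  then have "split_conjugation_space act X ori \<tau> i = {a \<in> carrier_mat (k (Suc j)) (k (Suc j)).
    \<exists>x\<in>carrier_mat (k (Suc (Suc j))) (k (Suc j)). \<exists>y\<in>carrier_mat (k (Suc j)) (k (Suc (Suc j))).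
      a = mat_star (D (Suc j)) * x + y * D (Suc j)}"
    unfolding split_conjugation_space_def j k_def[symmetric] D_def[symmetric] Suc_eq_plus1[symmetric]
    by blast
  also have "\<dots> = {a \<in> carrier_mat (k (Suc j)) (k (Suc j)). mat_star (D j) * a * D j = 0\<^sub>m (k j) (k j)}"
    using iff by blast
  also have "\<dots> = ker_conj_map act X ori \<tau> (i - 1)"
    by (simp add: ker_conj_map_def conj_map_def j flip: k_def D_def)
  finally show ?thesis ..
qed

end
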